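(* There exists an algorithm that, given (with probe access) a graph $G=(V,E)$ with maximum degree $\Delta\ge1$ and an integer $q\ge65\Delta$, a partial proper $q$-coloring $\sigma\in[q]^\Lambda$ of a subset of vertices $\Lambda\subset V$, a vertex $v\in V\setminus\Lambda$, and parameters $\varepsilon,\delta\in(0,1)$, outputs an estimate $\hat\mu_v^\sigma$ such that $$\Pr\left[\forall c\in[q]:\ (1-\varepsilon)\mu_v^\sigma(c)\le\hat\mu_v^\sigma(c)\le(1+\varepsilon)\mu_v^\sigma(c)\right]\ge1-\delta,$$ where $\mu$ denotes the uniform distribution over all proper $q$-colorings of $G$, in expected time $O\left(\varepsilon^{-2}\delta^{-1}\Delta^2q^3|\Lambda|\right)$.
   Context: A proper $q$-coloring of a finite graph $G=(V,E)$ is a map $\tau:V\to[q]$ with $\tau(u)\ne\tau(w)$ for all $(u,w)\in E$; a partial proper $q$-coloring of $\Lambda$ is $\sigma\in[q]^\Lambda$ with $\sigma(u)\neq\sigma(w)$ for every edge $(u,w)\in E$ with $u,w\in\Lambda$. For $v\in V\setminus\Lambda$, the conditional marginal distribution is $\mu_v^\sigma(c)=\Pr_{\tau\sim\mu}[\tau_v=c\mid\tau_\Lambda=\sigma]$ for $c\in[q]$. Probe access means: for each $v\in V$, each neighbor of $v$ can be accessed in $O(1)$ time.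
   Formalization: In the expected time bound, |Λ| is replaced by max(1, |Λ|), since for empty Λ the bound as written is 0, which no algorithm can meet; for non-empty Λ the statement is unchanged. *)

theory Defs
  imports "HOL-Probability.SPMF" "Graph_Theory.Pair_Digraph"
begin

section \<open>Graphs and colorings\<close>

text \<open>A finite simple graph is a \<^locale>\<open>pair_graph\<close>: finitely many vertices and a symmetric, loop-free
  set of ordered pairs, so the degree of a vertex is its out-degree.\<close>

definition max_degree :: "'v pair_pre_digraph \<Rightarrow> nat" where
  "max_degree G = Max (out_degree (with_proj G) ` pverts G)"

definition partial_proper_coloring :: "'v pair_pre_digraph \<Rightarrow> nat \<Rightarrow> 'v set \<Rightarrow> ('v \<Rightarrow> nat) \<Rightarrow> bool" where
  "partial_proper_coloring G q \<Lambda> \<sigma> \<longleftrightarrow>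
     \<sigma> \<in> \<Lambda> \<rightarrow>\<^sub>E {1..q} \<and> (\<forall>(u, w) \<in> parcs G. u \<in> \<Lambda> \<longrightarrow> w \<in> \<Lambda> \<longrightarrow> \<sigma> u \<noteq> \<sigma> w)"

definition proper_colorings :: "'v pair_pre_digraph \<Rightarrow> nat \<Rightarrow> ('v \<Rightarrow> nat) set" where
  "proper_colorings G q = {\<tau> \<in> pverts G \<rightarrow>\<^sub>E {1..q}. \<forall>(u, w) \<in> parcs G. \<tau> u \<noteq> \<tau> w}"

definition marginal ::
    "'v pair_pre_digraph \<Rightarrow> nat \<Rightarrow> 'v set \<Rightarrow> ('v \<Rightarrow> nat) \<Rightarrow> 'v \<Rightarrow> nat \<Rightarrow> real" where
  "marginal G q \<Lambda> \<sigma> v c =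
     \<P>(\<tau> in measure_pmf (pmf_of_set (proper_colorings G q)). \<tau> v = c \<bar> restrict \<tau> \<Lambda> = \<sigma>)"

section \<open>Randomized algorithms with probe access\<close>

text \<open>The machine is a randomized RAM with finitely many (statically named) infinite arrays, some
  holding natural numbers and some holding real numbers; an array used only at index 0 is a
  variable. As usual for unit-cost machines, the only arithmetic on natural numbers is addition
  and (truncated) subtraction, so natural numbers grow at most exponentially with time. Real numbers
  admit field operations and comparison, but neither rounding nor real constants: a
  program is a finite object without hidden information.\<close>

record state =
  nats :: "nat \<Rightarrow> nat \<Rightarrow> nat"
  reals :: "nat \<Rightarrow> nat \<Rightarrow> real"

datatype nexp =
    Const nat
  | NGet nat nexp
  | NPlus nexp nexp
  | NMinus nexp nexp

datatype rexp =
    OfNat nexp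
  | RGet nat nexp
  | RPlus rexp rexp
  | RMinus rexp rexp
  | RTimes rexp rexp
  | RDivide rexp rexp

datatype bexp =
    NLess nexp nexp
  | RLess rexp rexp
  | BNot bexp
  | BAnd bexp bexp

datatype com =
    Skip
  | NSet nat nexp nexp
  | RSet nat nexp rexp
  | Probe nat nexp nexp nexp
  | Rand nat nexp nexp
  | Seq com com
  | Cond bexp com com
  | While bexp com

primrec nval :: "nexp \<Rightarrow> state \<Rightarrow> nat" where
  "nval (Const n) s = n"
| "nval (NGet x i) s = nats s x (nval i s)"
| "nval (NPlus a b) s = nval a s + nval b s"
| "nval (NMinus a b) s = nval a s - nval b s"

primrec rval :: "rexp \<Rightarrow> state \<Rightarrow> real" where
  "rval (OfNat a) s = real (nval a s)"
| "rval (RGet x i) s = reals s x (nval i s)"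
| "rval (RPlus a b) s = rval a s + rval b s"
| "rval (RMinus a b) s = rval a s - rval b s"
| "rval (RTimes a b) s = rval a s * rval b s"
| "rval (RDivide a b) s = rval a s / rval b s"

primrec bval :: "bexp \<Rightarrow> state \<Rightarrow> bool" where
  "bval (NLess a b) s \<longleftrightarrow> nval a s < nval b s"
| "bval (RLess a b) s \<longleftrightarrow> rval a s < rval b s"
| "bval (BNot b) s \<longleftrightarrow> \<not> bval b s"
| "bval (BAnd a b) s \<longleftrightarrow> bval a s \<and> bval b s"

definition nset :: "nat \<Rightarrow> nat \<Rightarrow> nat \<Rightarrow> state \<Rightarrow> state" where
  "nset x i n s = s\<lparr>nats := (nats s)(x := (nats s x)(i := n))\<rparr>"

definition rset :: "nat \<Rightarrow> nat \<Rightarrow> real \<Rightarrow> state \<Rightarrow> state" where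
  "rset x i r s = s\<lparr>reals := (reals s)(x := (reals s x)(i := r))\<rparr>"

text \<open>The graph is visible only through adjacency lists. A probe asks for the neighbor number \<open>j\<close>
  (counted from 0) of \<open>u\<close>; the answer is the successor of the neighbor's name, or 0 if there is no
  such neighbor.\<close>

definition adjacency_lists :: "nat pair_pre_digraph \<Rightarrow> (nat \<Rightarrow> nat list) \<Rightarrow> bool" where
  "adjacency_lists G adj \<longleftrightarrow>
     (\<forall>u \<in> pverts G. distinct (adj u) \<and> set (adj u) = {w. (u, w) \<in> parcs G})"

definition probe :: "(nat \<Rightarrow> nat list) \<Rightarrow> nat \<Rightarrow> nat \<Rightarrow> nat" where
  "probe adj u j = (if j < length (adj u) then Suc (adj u ! j) else 0)"

text \<open>Joint law of the running time and the final state; the missing probability mass is the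
  probability of not terminating. Every elementary command and every evaluation of a branching or
  loop condition takes one unit of time (the expressions in a program have constant size).
  \<open>Rand x i a\<close> draws uniformly from \<open>{0..a}\<close>.\<close>

partial_function (spmf) exec :: "(nat \<Rightarrow> nat list) \<Rightarrow> com \<Rightarrow> state \<Rightarrow> (nat \<times> state) spmf" where
  "exec adj p s = (case p of
      Skip \<Rightarrow> return_spmf (1, s)
    | NSet x i a \<Rightarrow> return_spmf (1, nset x (nval i s) (nval a s) s)
    | RSet x i a \<Rightarrow> return_spmf (1, rset x (nval i s) (rval a s) s)
    | Probe x i a b \<Rightarrow> return_spmf (1, nset x (nval i s) (probe adj (nval a s) (nval b s)) s)
    | Rand x i a \<Rightarrow> map_spmf (\<lambda>r. (1, nset x (nval i s) r s)) (spmf_of_set {0..nval a s})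
    | Seq p1 p2 \<Rightarrow> bind_spmf (exec adj p1 s) (\<lambda>(t1, s1).
        bind_spmf (exec adj p2 s1) (\<lambda>(t2, s2). return_spmf (t1 + t2, s2)))
    | Cond b p1 p2 \<Rightarrow> bind_spmf (exec adj (if bval b s then p1 else p2) s) (\<lambda>(t1, s1).
        return_spmf (1 + t1, s1))
    | While b p1 \<Rightarrow>
        if bval b s then
          bind_spmf (exec adj p1 s) (\<lambda>(t1, s1).
            bind_spmf (exec adj (While b p1) s1) (\<lambda>(t2, s2). return_spmf (1 + t1 + t2, s2)))
        else return_spmf (1, s))"

definition expected_time :: "(nat \<times> state) spmf \<Rightarrow> ennreal" where
  "expected_time R =
     (if lossless_spmf R then \<integral>\<^sup>+ (t, s). of_nat t \<partial>measure_spmf R else \<infinity>)"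

text \<open>The partial coloring is given as the list \<open>vs\<close> of the colored vertices, in any order, together
  with their colors. Neither the maximum degree nor the number of vertices of the graph is part
  of the input. All memory not occupied by the input is 0.\<close>

definition load :: "'a::zero list \<Rightarrow> nat \<Rightarrow> 'a" where
  "load xs i = (if i < length xs then xs ! i else 0)"

definition input :: "nat \<Rightarrow> nat list \<Rightarrow> (nat \<Rightarrow> nat) \<Rightarrow> nat \<Rightarrow> real \<Rightarrow> real \<Rightarrow> state" where
  "input q vs \<sigma> v \<epsilon> \<delta> =
     \<lparr>nats = (\<lambda>_ _. 0)(0 := load [q, v, length vs], 1 := load vs, 2 := load (map \<sigma> vs)),
      reals = (\<lambda>_ _. 0)(0 := load [\<epsilon>, \<delta>])\<rparr>"

text \<open>The estimate for color \<open>c\<close> is left at index \<open>c\<close> of the real array number 1.\<close>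

definition estimate :: "state \<Rightarrow> nat \<Rightarrow> real" where
  "estimate s c = reals s 1 c"

end

theory Submission
  imports Defs
begin

text \<open>Let \<open>P k\<close> be the probability that a random extension of \<open>\<sigma>\<close> agrees with a partial coloring
  \<open>k\<close>. Resampling the color of a vertex \<open>u\<close> with \<open>k u = c\<close> gives, with \<open>N\<close> the neighborhood of \<open>u\<close>,
  the linear identity \<open>q P(k) = P(k - u, c not in N) + (\<Sum>c'. P(k, c' in N))\<close>, whose right-hand side
  expands by inclusion and exclusion over the neighbors of \<open>u\<close> into probabilities \<open>P k'\<close>. Choosing
  terms of the expansion at random, and reweighting, turns the identity into a random walk on
  partial colorings whose final weight is an unbiased estimator of \<open>P k\<close>. As \<open>q\<close> is large compared
  with the degree, the walk has negative drift, so it ends after \<open>O(\<Delta>)\<close> expected steps, and the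
  second moment of its weight is at most \<open>(2/q)\<close> to the power twice the number of vertices that \<open>k\<close>
  colors outside of \<open>\<Lambda>\<close>. For one vertex this is of the order of the square of the marginal, so
  by Chebyshev's inequality \<open>O(q / (\<epsilon>\<^sup>2 \<delta>))\<close> samples per color suffice.

  Running time and accuracy are bounded together, by upper bounds on the expectation of \<open>\<kappa>\<close> times the
  running time plus a function of the final state; \<open>\<kappa> = 1\<close> gives the running time, \<open>\<kappa> \<rightarrow> 0\<close> the
  failure probability.\<close>

section \<open>Expected cost of programs\<close>

text \<open>The weights of the walk are signed, because inclusion and exclusion subtracts, whereas
  the calculus below only bounds expectations of nonnegative functions from above. So the mean of
  the weight cannot be tracked alone. Instead the square \<open>\<beta> * (x + w)\<^sup>2\<close> is
  bounded for every real \<open>x\<close>: its linear term carries the mean exactly, and only its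
  quadratic term is estimated. Taking for \<open>x\<close> the deviation accumulated by earlier
  samples makes the cross terms cancel, so that neither unbiasedness nor independence of the samples
  has to be stated. A neighbor is colored with probability \<open>2 / q\<close> because one more
  colored vertex lowers the available bound on \<open>P\<close> by just this factor; the reweighting
  by \<open>q / 2\<close> is then balanced in the second moment. Relative error leaves no room when
  the marginal is 0. Such colors are exactly those that \<open>\<sigma>\<close> gives to a neighbor
  of \<open>v\<close>; they are recognized by probing and get the estimate 0. Every other marginal
  is at least \<open>63 / 65 / q\<close>, comparable with the root \<open>2 / q\<close> of the
  second moment of one sample.\<close>

lemma nn_integral_lub_spmf:
  fixes f :: "'a \<Rightarrow> ennreal"
  assumes chain: "Complete_Partial_Order.chain (ord_spmf (=)) Y" and Y: "Y \<noteq> {}"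
  shows "(\<integral>\<^sup>+ x. f x \<partial>measure_spmf (lub_spmf Y)) = (SUP y\<in>Y. \<integral>\<^sup>+ x. f x \<partial>measure_spmf y)"
proof -
  let ?M = "count_space (set_spmf (lub_spmf Y))"
  have chain': "Complete_Partial_Order.chain (\<le>) ((\<lambda>p x. ennreal (spmf p x) * f x) ` Y)"
    using chain by (rule chain_imageI)
      (auto simp: le_fun_def dest: ord_spmf_eq_leD intro!: mult_right_mono ennreal_leI)
  have "(\<integral>\<^sup>+ x. f x \<partial>measure_spmf (lub_spmf Y)) = (\<integral>\<^sup>+ x. ennreal (spmf (lub_spmf Y) x) * f x \<partial>?M)"
    by (rule nn_integral_measure_spmf')
  also have "\<dots> = (\<integral>\<^sup>+ x. (SUP y\<in>Y. ennreal (spmf y x) * f x) \<partial>?M)"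
    by (simp add: ennreal_spmf_lub_spmf[OF chain Y] SUP_mult_right_ennreal Y)
  also have "\<dots> = (SUP y\<in>Y. \<integral>\<^sup>+ x. ennreal (spmf y x) * f x \<partial>?M)"
    using Y chain' by (rule nn_integral_monotone_convergence_SUP_countable) simp
  also have "\<dots> = (SUP y\<in>Y. \<integral>\<^sup>+ x. ennreal (spmf y x) * f x \<partial>count_space UNIV)"
    by (auto simp: nn_integral_count_space_indicator set_lub_spmf[OF chain] spmf_eq_0_set_spmf
        split: split_indicator intro!: arg_cong [of _ _ Sup] image_cong nn_integral_cong)
  finally show ?thesis by (simp add: nn_integral_measure_spmf)
qed

text \<open>The expected-runtime transformer in the style of weakest preexpectations, charging
  \<open>k\<close> per time unit. The value \<top> lets a function \<open>f\<close> encode an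
  invariant: a finite bound then also shows that the invariant holds where \<open>f\<close> is
  evaluated.\<close>

primrec ert :: "(nat \<Rightarrow> nat list) \<Rightarrow> ennreal \<Rightarrow> com \<Rightarrow> (state \<Rightarrow> ennreal) \<Rightarrow> state \<Rightarrow> ennreal" where
  "ert adj k Skip f s = k + f s"
| "ert adj k (NSet x i a) f s = k + f (nset x (nval i s) (nval a s) s)"
| "ert adj k (RSet x i a) f s = k + f (rset x (nval i s) (rval a s) s)"
| "ert adj k (Probe x i a b) f s = k + f (nset x (nval i s) (probe adj (nval a s) (nval b s)) s)"
| "ert adj k (Rand x i a) f s =
     k + (\<integral>\<^sup>+ r. f (nset x (nval i s) r s) \<partial>measure_spmf (spmf_of_set {0..nval a s}))"
| "ert adj k (Seq p1 p2) f s = ert adj k p1 (ert adj k p2 f) s"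
| "ert adj k (Cond b p1 p2) f s = k + (if bval b s then ert adj k p1 f s else ert adj k p2 f s)"
| "ert adj k (While b p) f s =
     lfp (\<lambda>X s. k + (if bval b s then ert adj k p X s else f s)) s"

lemma ert_mono: "f \<le> g \<Longrightarrow> ert adj k p f \<le> ert adj k p g"
proof (induction p arbitrary: f g)
  case (Rand x i a)
  then show ?case by (auto simp: le_fun_def intro!: add_left_mono nn_integral_mono)
next
  case (While b p)
  show ?case unfolding le_fun_def ert.simps
    using While.prems by (auto simp: le_fun_def intro!: lfp_mono[THEN le_funD] add_left_mono)
qed (auto simp: le_fun_def intro!: add_left_mono)

lemma ert_While_unfold:
  "ert adj k (While b p) f s =
     k + (if bval b s then ert adj k p (ert adj k (While b p) f) s else f s)"
proof -
  let ?F = "\<lambda>X s. k + (if bval b s then ert adj k p X s else f s)"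
  have "mono ?F"
    by (rule monoI) (auto simp: le_fun_def intro!: add_left_mono ert_mono[THEN le_funD])
  from lfp_unfold[OF this] have "lfp ?F s = ?F (lfp ?F) s"
    by (rule fun_cong)
  moreover have "ert adj k (While b p) f = lfp ?F"
    by (rule ext) simp
  ultimately show ?thesis by simp
qed

text \<open>Park induction for the least fixed point. All loop bounds below use it with an
  \<open>I\<close> that is \<top> off the loop invariant, so that only states satisfying the
  invariant need an argument.\<close>

lemma ert_While_le:
  assumes "\<And>s. k + (if bval b s then ert adj k p I s else f s) \<le> I s"
  shows "ert adj k (While b p) f s \<le> I s"
  using lfp_lowerbound[of "\<lambda>X s. k + (if bval b s then ert adj k p X s else f s)" I] assms
  by (simp add: le_fun_def)

section \<open>Soundness of the transformer for the machine semantics\<close>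

definition cost :: "ennreal \<Rightarrow> (state \<Rightarrow> ennreal) \<Rightarrow> (nat \<times> state) spmf \<Rightarrow> ennreal" where
  "cost k f R = (\<integral>\<^sup>+ x. (k * of_nat (fst x) + f (snd x)) \<partial>measure_spmf R)"

lemma nn_integral_const_measure_spmf_le:
  "(\<integral>\<^sup>+ x. c \<partial>measure_spmf p) \<le> (c :: ennreal)"
proof -
  have "c * emeasure (measure_spmf p) (space (measure_spmf p)) \<le> c * 1"
    by (intro mult_left_mono measure_spmf.emeasure_space_le_1) simp
  then show ?thesis by simp
qed

lemma nn_integral_bind_spmf:
  "(\<integral>\<^sup>+ x. f x \<partial>measure_spmf (bind_spmf p g)) =
     (\<integral>\<^sup>+ y. (\<integral>\<^sup>+ x. f x \<partial>measure_spmf (g y)) \<partial>measure_spmf p)"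
  by (simp add: measure_spmf_bind nn_integral_bind[where B="count_space UNIV"] o_def)

lemma nn_integral_return_spmf [simp]:
  "(\<integral>\<^sup>+ x. f x \<partial>measure_spmf (return_spmf y)) = f y"
  by (simp add: measure_spmf_return_spmf nn_integral_return)

lemma cost_return [simp]: "cost k f (return_spmf (t, s)) = k * of_nat t + f s"
  by (simp add: cost_def)

text \<open>Only an inequality: when \<open>Q\<close> loses mass by diverging, the left side also
  loses the time already spent in \<open>R\<close>, which the right side charges in full.\<close>

lemma cost_bind_le:
  "cost k f (bind_spmf R (\<lambda>(t1, s1). bind_spmf (Q s1) (\<lambda>(t2, s2). return_spmf (t1 + t2, s2))))
     \<le> cost k (\<lambda>s1. cost k f (Q s1)) R"
proof -
  have "cost k f (bind_spmf (Q s1) (\<lambda>(t2, s2). return_spmf (t1 + t2, s2)))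
      \<le> k * of_nat t1 + cost k f (Q s1)" for t1 s1
  proof -
    have "cost k f (bind_spmf (Q s1) (\<lambda>(t2, s2). return_spmf (t1 + t2, s2))) =
        (\<integral>\<^sup>+ x. (k * of_nat t1 + (k * of_nat (fst x) + f (snd x))) \<partial>measure_spmf (Q s1))"
      unfolding cost_def
      by (simp add: nn_integral_bind_spmf case_prod_beta distrib_left add.assoc)
    also have "\<dots> = (\<integral>\<^sup>+ x. k * of_nat t1 \<partial>measure_spmf (Q s1)) + cost k f (Q s1)"
      by (simp add: cost_def nn_integral_add)
    also have "\<dots> \<le> k * of_nat t1 + cost k f (Q s1)"
      by (intro add_right_mono nn_integral_const_measure_spmf_le)
    finally show ?thesis .
  qed
  moreover have "cost k f (bind_spmf R h) = (\<integral>\<^sup>+ x. cost k f (h x) \<partial>measure_spmf R)" for h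
    unfolding cost_def
    by (rule nn_integral_bind_spmf)
  ultimately show ?thesis
    unfolding cost_def[of k "\<lambda>s1. cost k f (Q s1)"]
    by (auto intro!: nn_integral_mono split: prod.split)
qed

lemma cost_mono: "f \<le> g \<Longrightarrow> cost k f R \<le> cost k g R"
  unfolding cost_def by (intro nn_integral_mono add_left_mono) (simp add: le_fun_def)

lemma cost_shift_le:
  "cost k f (bind_spmf R (\<lambda>(t1, s1). return_spmf (1 + t1, s1))) \<le> k + cost k f R"
proof -
  have "cost k f (bind_spmf R (\<lambda>(t1, s1). return_spmf (1 + t1, s1))) =
     cost k f (bind_spmf (return_spmf (1, undefined :: state))
       (\<lambda>(t1, s1). bind_spmf R (\<lambda>(t2, s2). return_spmf (t1 + t2, s2))))"
    by simp
  also have "\<dots> \<le> cost k (\<lambda>s1. cost k f R) (return_spmf (1::nat, undefined :: state))"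
    by (rule cost_bind_le)
  finally show ?thesis by simp
qed

lemma cost_exec_le_ert: "cost k f (exec adj p s) \<le> ert adj k p f s"
proof (induction arbitrary: p f s rule: exec.fixp_induct)
  case 1
  \<comment> \<open>Cost is continuous along chains of approximations by monotone convergence, so an
    upper bound passes to the limit.\<close>
  have "spmf.admissible (\<lambda>h. cost k f (h x) \<le> c)" for f c and x :: "((nat \<Rightarrow> nat list) \<times> com) \<times> state"
  proof (rule ccpo.admissibleI)
    fix C :: "(((nat \<Rightarrow> nat list) \<times> com) \<times> state \<Rightarrow> (nat \<times> state) spmf) set"
    assume C: "Complete_Partial_Order.chain (fun_ord (ord_spmf (=))) C" "C \<noteq> {}"
      and le: "\<forall>h\<in>C. cost k f (h x) \<le> c"
    have "Complete_Partial_Order.chain (ord_spmf (=)) {y. \<exists>h\<in>C. y = h x}"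
      using chain_fun[OF C(1)] .
    then have "cost k f (fun_lub lub_spmf C x) = (SUP y\<in>{y. \<exists>h\<in>C. y = h x}. cost k f y)"
      unfolding cost_def fun_lub_def using C(2) by (subst nn_integral_lub_spmf) auto
    also have "\<dots> \<le> c"
      using le by (auto intro!: SUP_least)
    finally show "cost k f (fun_lub lub_spmf C x) \<le> c" .
  qed
  then show ?case by (intro admissible_all) simp
next
  case 2
  then show ?case by (simp add: cost_def)
next
  case (3 ex)
  have seq: "cost k f (bind_spmf (ex adj p1 s) (\<lambda>(t1, s1). bind_spmf (ex adj p2 s1)
      (\<lambda>(t2, s2). return_spmf (t1 + t2, s2)))) \<le> ert adj k p1 (ert adj k p2 f) s" for p1 p2 f s
  proof -
    note cost_bind_le
    also have "cost k (\<lambda>s1. cost k f (ex adj p2 s1)) (ex adj p1 s) \<le> cost k (ert adj k p2 f) (ex adj p1 s)"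
      by (rule cost_mono) (simp add: le_fun_def 3)
    also have "\<dots> \<le> ert adj k p1 (ert adj k p2 f) s" by (rule 3)
    finally show ?thesis .
  qed
  show ?case
  proof (cases p)
    case (Rand x i a)
    have "(\<integral>\<^sup>+ r. (k + f (nset x (nval i s) r s)) \<partial>measure_spmf (spmf_of_set {0..nval a s}))
       \<le> k + (\<integral>\<^sup>+ r. f (nset x (nval i s) r s) \<partial>measure_spmf (spmf_of_set {0..nval a s}))"
      by (simp add: nn_integral_add add_right_mono nn_integral_const_measure_spmf_le
          del: nn_integral_const)
    then show ?thesis using Rand by (simp add: cost_def o_def)
  next
    case (Seq p1 p2)
    then show ?thesis using seq by simp
  next
    case (Cond b p1 p2)
    have "cost k f (bind_spmf (ex adj (if bval b s then p1 else p2) s) (\<lambda>(t1, s1). return_spmf (1 + t1, s1)))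
        \<le> k + ert adj k (if bval b s then p1 else p2) f s"
      by (rule order_trans[OF cost_shift_le add_left_mono[OF 3]])
    then show ?thesis using Cond by (simp split: if_splits)
  next
    case (While b p1)
    show ?thesis
    proof (cases "bval b s")
      case True
      let ?R = "bind_spmf (ex adj p1 s) (\<lambda>(t1, s1). bind_spmf (ex adj (While b p1) s1)
          (\<lambda>(t2, s2). return_spmf (t1 + t2, s2)))"
      have "bind_spmf (ex adj p1 s) (\<lambda>(t1, s1). bind_spmf (ex adj (While b p1) s1)
          (\<lambda>(t2, s2). return_spmf (1 + t1 + t2, s2)))
        = bind_spmf ?R (\<lambda>(t1, s1). return_spmf (1 + t1, s1))"
        by (simp add: case_prod_unfold add.assoc)
      also have "cost k f \<dots> \<le> k + cost k f ?R" by (rule cost_shift_le)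
      also have "\<dots> \<le> k + ert adj k p1 (ert adj k (While b p1) f) s"
        by (intro add_left_mono seq)
      also have "\<dots> = ert adj k (While b p1) f s"
        using ert_While_unfold[of adj k b p1 f s] True by (simp del: ert.simps)
      finally show ?thesis using While True by simp
    next
      case False
      then show ?thesis using While by (subst While, subst ert_While_unfold) simp
    qed
  qed simp_all
qed

text \<open>Termination must be shown separately, since \<open>cost\<close> does not see divergent
  runs. For a loop, an iteration preserves the divergence probability \<open>\<phi>\<close> in
  expectation, as the body itself terminates almost surely. Each iteration is charged
  \<open>k\<close>, so \<open>n * k * \<phi> s\<close> stays below the finite value of
  \<open>ert\<close> for every \<open>n\<close>, which forces \<open>\<phi> s = 0\<close>.\<close>

lemma lossless_exec:
  assumes "k > 0"
  shows "ert adj k p f s < \<top> \<Longrightarrow> lossless_spmf (exec adj p s)"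
proof (induction p arbitrary: f s)
  case (Seq p1 p2)
  have l1: "lossless_spmf (exec adj p1 s)" using Seq by simp
  have "cost k (ert adj k p2 f) (exec adj p1 s) < \<top>"
    using Seq.prems cost_exec_le_ert[of k "ert adj k p2 f"] by (auto intro: le_less_trans)
  then have "AE x in measure_spmf (exec adj p1 s). k * of_nat (fst x) + ert adj k p2 f (snd x) \<noteq> \<infinity>"
    unfolding cost_def by (intro nn_integral_PInf_AE) auto
  then have "lossless_spmf (exec adj p2 (snd x))" if "x \<in> set_spmf (exec adj p1 s)" for x
    using that Seq.IH(2)[of f "snd x"] by (auto simp: less_top)
  then show ?case using l1 by (subst exec.simps) (auto simp: split: prod.split)
next
  case (Cond b p1 p2)
  then show ?case by (subst exec.simps) (auto split: if_splits)
next
  case (While b p)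
  let ?W = "While b p"
  define \<phi> where "\<phi> s = ennreal (1 - weight_spmf (exec adj ?W s))" for s
  have bound: "of_nat n * k * \<phi> s \<le> ert adj k ?W f s" for n s
  proof (induction n arbitrary: s)
    case 0
    then show ?case by simp
  next
    case (Suc n)
    show ?case
    proof (cases "bval b s \<and> ert adj k ?W f s < \<top>")
      case True
      let ?E = "ert adj k ?W f"
      have eq: "?E s = k + ert adj k p ?E s" using True by (subst ert_While_unfold) simp
      then have fin: "ert adj k p ?E s < \<top>" using True by (auto simp: less_top)
      then have l1: "lossless_spmf (exec adj p s)" by (rule While.IH)
      have ex: "exec adj ?W s = bind_spmf (exec adj p s) (\<lambda>(t1, s1).
          bind_spmf (exec adj ?W s1) (\<lambda>(t2, s2). return_spmf (1 + t1 + t2, s2)))"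
        using True by (subst exec.simps) simp
      have w: "weight_spmf (exec adj ?W s) =
          (\<integral>x. weight_spmf (exec adj ?W (snd x)) \<partial>measure_spmf (exec adj p s))"
        unfolding ex by (simp add: weight_bind_spmf o_def case_prod_beta)
      have "1 - weight_spmf (exec adj ?W s) =
          (\<integral>x. 1 - weight_spmf (exec adj ?W (snd x)) \<partial>measure_spmf (exec adj p s))"
        using l1 by (subst Bochner_Integration.integral_diff)
          (auto simp: w lossless_weight_spmfD weight_spmf_le_1
            intro!: measure_spmf.integrable_const_bound[where B=1])
      then have \<phi>: "\<phi> s = (\<integral>\<^sup>+ x. \<phi> (snd x) \<partial>measure_spmf (exec adj p s))"
        unfolding \<phi>_def
        by (subst nn_integral_eq_integral)
          (auto simp: weight_spmf_le_1 intro!: measure_spmf.integrable_const_bound[where B=1])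
      have "\<phi> s \<le> 1" unfolding \<phi>_def by simp
      then have "of_nat (Suc n) * k * \<phi> s \<le> k + of_nat n * k * \<phi> s"
        using mult_left_mono[of "\<phi> s" 1 k] by (simp add: distrib_right add_right_mono)
      also have "of_nat n * k * \<phi> s =
          (\<integral>\<^sup>+ x. of_nat n * k * \<phi> (snd x) \<partial>measure_spmf (exec adj p s))"
        by (simp add: \<phi> nn_integral_cmult)
      also have "\<dots> \<le> cost k ?E (exec adj p s)"
        unfolding cost_def using Suc.IH
        by (intro nn_integral_mono) (simp add: add_increasing)
      also have "\<dots> \<le> ert adj k p ?E s" by (rule cost_exec_le_ert)
      finally show ?thesis using eq by (simp add: add_left_mono)
    next
      case False
      show ?thesis
      proof (cases "bval b s")
        case True
        then have "ert adj k ?W f s = \<top>" using False True by (simp add: less_top[symmetric] del: ert.simps)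
          then show ?thesis by simp
      next
        case False
        then have "exec adj ?W s = return_spmf (1, s)" by (subst exec.simps) simp
          then have "\<phi> s = 0" unfolding \<phi>_def by (simp only: weight_return_spmf) simp
        then show ?thesis by simp
      qed
    qed
  qed
  have "\<phi> s = 0"
  proof (rule ccontr)
    assume "\<phi> s \<noteq> 0"
    then have "k * \<phi> s > 0" using assms by (auto simp: ennreal_zero_less_mult_iff zero_less_iff_neq_zero)
    moreover obtain r where r: "ert adj k ?W f s = ennreal r" "r \<ge> 0"
      using While.prems by (cases "ert adj k ?W f s") auto
    moreover have "k * \<phi> s < \<top>"
      using bound[of 1 s] While.prems by (auto intro: le_less_trans)
    then obtain c where c: "k * \<phi> s = ennreal c" "c \<ge> 0" by (cases "k * \<phi> s") auto
    ultimately have "c > 0" by (metis ennreal_less_zero_iff)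
    then obtain n :: nat where "r < real n * c" using reals_Archimedean3 by blast
    then have "ennreal r < of_nat n * ennreal c"
      using r by (simp add: ennreal_of_nat_eq_real_of_nat ennreal_mult'[symmetric] ennreal_lessI)
    then show False using bound[of n s] r c by (simp add: mult.assoc)
  qed
  then have "weight_spmf (exec adj ?W s) \<ge> 1" unfolding \<phi>_def by (simp add: ennreal_eq_0_iff)
  then show ?case using weight_spmf_le_1[of "exec adj ?W s"] by (simp add: lossless_spmf_def)
qed (subst exec.simps, simp)+

section \<open>Counting extensions of partial colorings\<close>

lemma sum_card_swap:
  assumes "finite A" "finite B"
  shows "(\<Sum>b\<in>B. card {a \<in> A. R a b}) = (\<Sum>a\<in>A. card {b \<in> B. R a b})"
proof -
  have "(\<Sum>b\<in>B. card {a \<in> A. R a b}) = (\<Sum>b\<in>B. \<Sum>a\<in>A. of_bool (R a b))"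
    using assms by (intro sum.cong refl) (simp add: sum.If_cases of_bool_def Int_def)
  also have "\<dots> = (\<Sum>a\<in>A. \<Sum>b\<in>B. of_bool (R a b))" by (rule sum.swap)
  also have "\<dots> = (\<Sum>a\<in>A. card {b \<in> B. R a b})"
    using assms by (intro sum.cong refl) (simp add: sum.If_cases of_bool_def Int_def)
  finally show ?thesis .
qed

text \<open>A partial coloring is represented by a function into the naturals, with 0 for uncolored.\<close>

definition agrees :: "('v \<Rightarrow> nat) \<Rightarrow> ('v \<Rightarrow> nat) \<Rightarrow> bool" where
  "agrees k \<tau> \<longleftrightarrow> (\<forall>x. k x \<noteq> 0 \<longrightarrow> \<tau> x = k x)"

lemma agrees_upd: "k y = 0 \<Longrightarrow> c \<noteq> 0 \<Longrightarrow> agrees (k(y := c)) \<tau> \<longleftrightarrow> agrees k \<tau> \<and> \<tau> y = c"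
  unfolding agrees_def fun_upd_apply by metis

locale coloring_instance =
  fixes G :: "nat pair_pre_digraph" and adj :: "nat \<Rightarrow> nat list" and q :: nat
    and \<Lambda> :: "nat set" and \<sigma> :: "nat \<Rightarrow> nat" and v :: nat and \<Delta> :: nat
  assumes graph: "pair_graph G" and adj: "adjacency_lists G adj"
    and \<Delta>_eq: "\<Delta> = max_degree G" and \<Delta>_pos: "1 \<le> \<Delta>" and q_ge: "65 * \<Delta> \<le> q"
    and \<Lambda>_sub: "\<Lambda> \<subseteq> pverts G" and \<sigma>: "partial_proper_coloring G q \<Lambda> \<sigma>"
    and v: "v \<in> pverts G - \<Lambda>"
begin

lemma finite_V: "finite (pverts G)"
  using graph by (simp add: pair_graph_def pair_digraph_def pair_fin_digraph_def
      pair_fin_digraph_axioms_def)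

lemma arc_sym: "(a, b) \<in> parcs G \<Longrightarrow> (b, a) \<in> parcs G"
proof -
  interpret pair_graph G by (rule graph)
  show "(a, b) \<in> parcs G \<Longrightarrow> (b, a) \<in> parcs G" by (rule arcs_symmetric)
qed

lemma arc_verts: "(a, b) \<in> parcs G \<Longrightarrow> a \<in> pverts G \<and> b \<in> pverts G"
proof -
  interpret pair_graph G by (rule graph)
  show "(a, b) \<in> parcs G \<Longrightarrow> a \<in> pverts G \<and> b \<in> pverts G"
    by (auto dest: in_arcsD1 in_arcsD2)
qed

lemma arc_irrefl: "(a, a) \<notin> parcs G"
proof -
  interpret pair_graph G by (rule graph)
  show ?thesis by (auto dest: no_loops')
qed

lemma set_adj: "u \<in> pverts G \<Longrightarrow> set (adj u) = {w. (u, w) \<in> parcs G}"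
  and distinct_adj: "u \<in> pverts G \<Longrightarrow> distinct (adj u)"
  using adj by (auto simp: adjacency_lists_def)

lemma adj_verts: "u \<in> pverts G \<Longrightarrow> set (adj u) \<subseteq> pverts G"
  using arc_verts by (auto simp: set_adj)

lemma length_adj: "u \<in> pverts G \<Longrightarrow> length (adj u) \<le> \<Delta>"
proof -
  assume u: "u \<in> pverts G"
  have "out_arcs (with_proj G) u = Pair u ` set (adj u)"
    using u by (auto simp: set_adj out_arcs_def)
  then have "out_degree (with_proj G) u = length (adj u)"
    using u by (simp add: out_degree_def card_image inj_on_def distinct_card distinct_adj)
  moreover have "out_degree (with_proj G) u \<le> max_degree G"
    unfolding max_degree_def using u finite_V by (intro Max_ge) auto
  ultimately show ?thesis by (simp add: \<Delta>_eq)
qed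

lemma q_pos: "65 \<le> q"
  using \<Delta>_pos q_ge by simp

abbreviation S :: "(nat \<Rightarrow> nat) set" where "S \<equiv> proper_colorings G q"

lemma finite_S: "finite S"
proof (rule finite_subset)
  show "S \<subseteq> pverts G \<rightarrow>\<^sub>E {1..q}" by (auto simp: proper_colorings_def)
  show "finite (pverts G \<rightarrow>\<^sub>E {1..q})" by (intro finite_PiE finite_V) simp
qed

definition k\<^sub>0 :: "nat \<Rightarrow> nat" where "k\<^sub>0 x = (if x \<in> \<Lambda> then \<sigma> x else 0)"

lemma \<sigma>_range: "x \<in> \<Lambda> \<Longrightarrow> \<sigma> x \<in> {1..q}"
  using \<sigma> by (auto simp: partial_proper_coloring_def)

definition cnt :: "(nat \<Rightarrow> nat) \<Rightarrow> ((nat \<Rightarrow> nat) \<Rightarrow> bool) \<Rightarrow> nat" where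
  "cnt k \<phi> = card {\<tau> \<in> S. agrees k \<tau> \<and> \<phi> \<tau>}"

lemma cnt_mono: "(\<And>\<tau>. \<tau> \<in> S \<Longrightarrow> agrees k \<tau> \<Longrightarrow> \<phi> \<tau> \<Longrightarrow> agrees k' \<tau> \<and> \<psi> \<tau>) \<Longrightarrow> cnt k \<phi> \<le> cnt k' \<psi>"
  unfolding cnt_def by (rule card_mono) (auto simp: finite_S)

lemma cnt_cong: "(\<And>\<tau>. \<tau> \<in> S \<Longrightarrow> agrees k \<tau> \<and> \<phi> \<tau> \<longleftrightarrow> agrees k' \<tau> \<and> \<psi> \<tau>) \<Longrightarrow> cnt k \<phi> = cnt k' \<psi>"
  unfolding cnt_def by (rule arg_cong[where f=card]) auto

lemma cnt_split: "cnt k \<phi> = cnt k (\<lambda>\<tau>. \<phi> \<tau> \<and> \<psi> \<tau>) + cnt k (\<lambda>\<tau>. \<phi> \<tau> \<and> \<not> \<psi> \<tau>)"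
  unfolding cnt_def by (subst card_Un_disjoint[symmetric])
    (auto simp: finite_S intro!: arg_cong[where f=card])

text \<open>Both sides count pairs of a coloring \<open>\<tau>\<close> agreeing with \<open>k\<close> and a color \<open>c'\<close>, according to
  whether \<open>u\<close> may be recolored with \<open>c'\<close>; if it may, exchanging \<open>c'\<close> and \<open>k u\<close> at \<open>u\<close> is bijective.\<close>

lemma cnt_resample:
  assumes u: "u \<in> pverts G" and c: "k u \<in> {1..q}"
  shows "q * cnt k (\<lambda>_. True) =
    cnt (k(u := 0)) (\<lambda>\<tau>. \<forall>y\<in>set (adj u). \<tau> y \<noteq> k u) +
    (\<Sum>c'\<in>{1..q}. cnt k (\<lambda>\<tau>. \<exists>y\<in>set (adj u). \<tau> y = c'))"
proof -
  let ?T = "{\<tau> \<in> S. agrees k \<tau>}"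
  let ?free = "\<lambda>\<tau> c'. \<forall>y\<in>set (adj u). \<tau> y \<noteq> (c'::nat)"
  have nbr: "y \<in> set (adj u) \<longleftrightarrow> (u, y) \<in> parcs G" for y using u by (simp add: set_adj)
  have u_nbr: "u \<notin> set (adj u)" by (simp add: nbr arc_irrefl)
  have proper: "\<tau>(u := c') \<in> S" if "\<tau> \<in> S" "c' \<in> {1..q}" "?free \<tau> c'" for \<tau> c'
  proof -
    have "\<tau>(u := c') \<in> pverts G \<rightarrow>\<^sub>E {1..q}"
      using that u by (auto simp: proper_colorings_def PiE_iff extensional_def)
    moreover have "(\<tau>(u := c')) a \<noteq> (\<tau>(u := c')) b" if ab: "(a, b) \<in> parcs G" for a b
    proof -
      have "\<tau> a \<noteq> \<tau> b" using ab \<open>\<tau> \<in> S\<close> by (auto simp: proper_colorings_def)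
      moreover have "\<tau> b \<noteq> c'" if "a = u" using that ab \<open>?free \<tau> c'\<close> by (auto simp: nbr)
      moreover have "\<tau> a \<noteq> c'" if "b = u"
        using that arc_sym[OF ab] \<open>?free \<tau> c'\<close> by (auto simp: nbr)
      moreover have "a \<noteq> b" using ab arc_irrefl by auto
      ultimately show ?thesis by auto
    qed
    ultimately show ?thesis unfolding proper_colorings_def by blast
  qed
  have own: "?free \<tau> (\<tau> u)" if "\<tau> \<in> S" for \<tau>
    using that by (fastforce simp: proper_colorings_def nbr)
  have free_upd: "?free (\<tau>(u := d)) c' \<longleftrightarrow> ?free \<tau> c'" for \<tau> c' d
    using u_nbr by auto
  have fixed: "\<tau> u = k u" if "agrees k \<tau>" for \<tau> using that c by (simp add: agrees_def)
  have agrees_upd0: "agrees (k(u := 0)) (\<tau>(u := c'))" if "agrees k \<tau>" for \<tau> c'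
    using that by (simp add: agrees_def)
  have "card {\<tau> \<in> S. agrees (k(u := 0)) \<tau> \<and> ?free \<tau> (k u)} =
      card (SIGMA \<tau>:?T. {c' \<in> {1..q}. ?free \<tau> c'})"
  proof (rule bij_betw_same_card[symmetric])
    show "bij_betw (\<lambda>(\<tau>, c'). \<tau>(u := c')) (SIGMA \<tau>:?T. {c' \<in> {1..q}. ?free \<tau> c'})
        {\<tau> \<in> S. agrees (k(u := 0)) \<tau> \<and> ?free \<tau> (k u)}"
    proof (rule bij_betw_byWitness[where f' = "\<lambda>\<tau>. (\<tau>(u := k u), \<tau> u)"])
      show "\<forall>x\<in>SIGMA \<tau>:?T. {c' \<in> {1..q}. ?free \<tau> c'}.
          (\<lambda>\<tau>. (\<tau>(u := k u), \<tau> u)) ((\<lambda>(\<tau>, c'). \<tau>(u := c')) x) = x"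
        using fixed by auto
      show "(\<lambda>(\<tau>, c'). \<tau>(u := c')) ` (SIGMA \<tau>:?T. {c' \<in> {1..q}. ?free \<tau> c'})
          \<subseteq> {\<tau> \<in> S. agrees (k(u := 0)) \<tau> \<and> ?free \<tau> (k u)}"
      proof -
        have "\<tau>(u := c') \<in> S \<and> agrees (k(u := 0)) (\<tau>(u := c')) \<and> ?free (\<tau>(u := c')) (k u)"
          if "\<tau> \<in> S" "agrees k \<tau>" "c' \<in> {1..q}" "?free \<tau> c'" for \<tau> c'
          using that proper[OF that(1,3,4)] own[OF that(1)] unfolding free_upd
          by (simp add: fixed agrees_upd0)
        then show ?thesis
          by (intro image_subsetI, elim SigmaE, clarify)
      qed
      show "(\<lambda>\<tau>. (\<tau>(u := k u), \<tau> u)) ` {\<tau> \<in> S. agrees (k(u := 0)) \<tau> \<and> ?free \<tau> (k u)}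
          \<subseteq> (SIGMA \<tau>:?T. {c' \<in> {1..q}. ?free \<tau> c'})"
      proof (intro image_subsetI)
        fix \<tau> assume "\<tau> \<in> {\<tau> \<in> S. agrees (k(u := 0)) \<tau> \<and> ?free \<tau> (k u)}"
        then have a: "\<tau> \<in> S" "agrees (k(u := 0)) \<tau>" "?free \<tau> (k u)" by blast+
        have "\<tau> u \<in> {1..q}" using a(1) u by (auto simp: proper_colorings_def)
        moreover have "agrees k (\<tau>(u := k u))" using a(2) by (simp add: agrees_def)
        moreover have "?free (\<tau>(u := k u)) (\<tau> u)" unfolding free_upd by (rule own[OF a(1)])
        ultimately show "(\<tau>(u := k u), \<tau> u) \<in> (SIGMA \<tau>:?T. {c' \<in> {1..q}. ?free \<tau> c'})"
          using proper[OF a(1) c a(3)] by blast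
      qed
    qed auto
  qed
  also have "\<dots> = (\<Sum>\<tau>\<in>?T. card {c' \<in> {1..q}. ?free \<tau> c'})"
    by (intro card_SigmaI) (auto simp: finite_S)
  finally have 1: "cnt (k(u := 0)) (\<lambda>\<tau>. ?free \<tau> (k u)) = (\<Sum>\<tau>\<in>?T. card {c' \<in> {1..q}. ?free \<tau> c'})"
    by (simp add: cnt_def)
  have 2: "(\<Sum>c'\<in>{1..q}. cnt k (\<lambda>\<tau>. \<exists>y\<in>set (adj u). \<tau> y = c')) =
      (\<Sum>\<tau>\<in>?T. card {c' \<in> {1..q}. \<exists>y\<in>set (adj u). \<tau> y = c'})"
    using sum_card_swap[of ?T "{1..q}" "\<lambda>\<tau> c'. \<exists>y\<in>set (adj u). \<tau> y = c'"] finite_S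
    by (simp add: cnt_def conj_assoc)
  have "card {c' \<in> {1..q}. ?free \<tau> c'} + card {c' \<in> {1..q}. \<exists>y\<in>set (adj u). \<tau> y = c'} = q" for \<tau>
  proof -
    let ?A = "{c' \<in> {1..q}. ?free \<tau> c'}" and ?B = "{c' \<in> {1..q}. \<exists>y\<in>set (adj u). \<tau> y = c'}"
    have "?A \<union> ?B = {1..q}" "?A \<inter> ?B = {}" by blast+
    then show ?thesis using card_Un_disjoint[of ?A ?B] by simp
  qed
  then show ?thesis unfolding 1 2 by (simp add: sum.distrib[symmetric] cnt_def)
qed

text \<open>The sum counts pairs of a coloring and a color seen around \<open>u\<close>; a coloring
  shows at most \<Delta> colors there.\<close>

lemma sum_cnt_nbr_le:
  assumes u: "u \<in> pverts G"
  shows "(\<Sum>c'\<in>{1..q}. cnt k (\<lambda>\<tau>. \<exists>y\<in>set (adj u). \<tau> y = c')) \<le> \<Delta> * cnt k (\<lambda>_. True)"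
proof -
  let ?T = "{\<tau> \<in> S. agrees k \<tau>}"
  have "(\<Sum>c'\<in>{1..q}. cnt k (\<lambda>\<tau>. \<exists>y\<in>set (adj u). \<tau> y = c')) =
      (\<Sum>\<tau>\<in>?T. card {c' \<in> {1..q}. \<exists>y\<in>set (adj u). \<tau> y = c'})"
    using sum_card_swap[of ?T "{1..q}" "\<lambda>\<tau> c'. \<exists>y\<in>set (adj u). \<tau> y = c'"] finite_S
    by (simp add: cnt_def conj_assoc)
  also have "\<dots> \<le> (\<Sum>\<tau>\<in>?T. \<Delta>)"
  proof (rule sum_mono)
    fix \<tau>
    have "card {c' \<in> {1..q}. \<exists>y\<in>set (adj u). \<tau> y = c'} \<le> card (\<tau> ` set (adj u))"
      by (rule card_mono) auto
    also have "\<dots> \<le> length (adj u)"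
      using card_image_le[of "set (adj u)" \<tau>] card_length[of "adj u"] by simp
    finally show "card {c' \<in> {1..q}. \<exists>y\<in>set (adj u). \<tau> y = c'} \<le> \<Delta>"
      using length_adj[OF u] by simp
  qed
  finally show ?thesis by (simp add: cnt_def mult.commute)
qed

text \<open>Greedy coloring outside of \<Lambda>: the neighbors of a vertex forbid at most \<Delta>
  < \<open>q\<close> colors. This makes the event of extending \<sigma> nonempty, hence the
  denominator of \<open>P\<close> positive.\<close>

lemma extend_coloring:
  assumes "finite W" "W \<subseteq> pverts G" "W \<inter> \<Lambda> = {}"
  shows "\<exists>\<tau> \<in> \<Lambda> \<union> W \<rightarrow>\<^sub>E {1..q}. (\<forall>x\<in>\<Lambda>. \<tau> x = \<sigma> x) \<and>
    (\<forall>(a, b)\<in>parcs G. a \<in> \<Lambda> \<union> W \<longrightarrow> b \<in> \<Lambda> \<union> W \<longrightarrow> \<tau> a \<noteq> \<tau> b)"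
  using assms
proof (induction W)
  case empty
  then show ?case using \<sigma> by (intro bexI[of _ \<sigma>]) (auto simp: partial_proper_coloring_def)
next
  case (insert x W)
  then obtain \<tau> where \<tau>: "\<tau> \<in> \<Lambda> \<union> W \<rightarrow>\<^sub>E {1..q}" "\<forall>x\<in>\<Lambda>. \<tau> x = \<sigma> x"
    "\<forall>(a, b)\<in>parcs G. a \<in> \<Lambda> \<union> W \<longrightarrow> b \<in> \<Lambda> \<union> W \<longrightarrow> \<tau> a \<noteq> \<tau> b"
    by auto
  have x: "x \<in> pverts G" "x \<notin> \<Lambda> \<union> W" using insert by auto
  have "card (\<tau> ` set (adj x)) \<le> length (adj x)"
    using card_image_le[of "set (adj x)" \<tau>] card_length[of "adj x"] by simp
  then have "card (\<tau> ` set (adj x)) < card {1..q}"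
    using length_adj[OF x(1)] q_ge \<Delta>_pos by simp
  then obtain c where c: "c \<in> {1..q}" "c \<notin> \<tau> ` set (adj x)"
    by (metis List.finite_set card_mono finite_imageI leD subsetI)
  have nbr: "y \<in> set (adj x) \<longleftrightarrow> (x, y) \<in> parcs G" for y using x by (simp add: set_adj)
  have "(\<tau>(x := c)) a \<noteq> (\<tau>(x := c)) b"
    if "(a, b) \<in> parcs G" "a \<in> \<Lambda> \<union> insert x W" "b \<in> \<Lambda> \<union> insert x W" for a b
  proof -
    have "a \<noteq> b" using that(1) arc_irrefl by auto
    moreover have "\<tau> b \<noteq> c" if "a = x"
      using that c(2) \<open>(a, b) \<in> parcs G\<close> nbr by blast
    moreover have "\<tau> a \<noteq> c" if "b = x"
      using that c(2) arc_sym[OF \<open>(a, b) \<in> parcs G\<close>] nbr by blast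
    moreover have "\<tau> a \<noteq> \<tau> b" if "a \<noteq> x" "b \<noteq> x"
      using that \<open>(a, b) \<in> parcs G\<close> \<open>a \<in> \<Lambda> \<union> insert x W\<close> \<open>b \<in> \<Lambda> \<union> insert x W\<close> \<tau>(3) by blast
    ultimately show ?thesis by auto
  qed
  moreover have "\<tau>(x := c) \<in> \<Lambda> \<union> insert x W \<rightarrow>\<^sub>E {1..q}"
    using \<tau>(1) c(1) by (auto simp: PiE_iff extensional_def)
  moreover have "\<forall>y\<in>\<Lambda>. (\<tau>(x := c)) y = \<sigma> y" using \<tau>(2) x(2) by auto
  ultimately show ?case by (intro bexI[of _ "\<tau>(x := c)"] conjI) blast+
qed

lemma cnt_k0_pos: "0 < cnt k\<^sub>0 (\<lambda>_. True)"
proof -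
  have "\<Lambda> \<union> (pverts G - \<Lambda>) = pverts G" using \<Lambda>_sub by auto
  then obtain \<tau> where "\<tau> \<in> pverts G \<rightarrow>\<^sub>E {1..q}" "\<forall>x\<in>\<Lambda>. \<tau> x = \<sigma> x"
    "\<forall>(a, b)\<in>parcs G. a \<in> pverts G \<longrightarrow> b \<in> pverts G \<longrightarrow> \<tau> a \<noteq> \<tau> b"
    using extend_coloring[of "pverts G - \<Lambda>"] finite_V by auto
  then have "\<tau> \<in> {\<tau> \<in> S. agrees k\<^sub>0 \<tau> \<and> True}"
    using arc_verts by (auto simp: proper_colorings_def agrees_def k\<^sub>0_def)
  then show ?thesis unfolding cnt_def card_gt_0_iff using finite_S by auto
qed

text \<open>The probability that a random extension of \<open>\<sigma>\<close> agrees with \<open>k\<close>, and that in addition no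
  (some) vertex of a list has color \<open>c\<close>.\<close>

definition P :: "(nat \<Rightarrow> nat) \<Rightarrow> real" where
  "P k = real (cnt k (\<lambda>_. True)) / real (cnt k\<^sub>0 (\<lambda>_. True))"

definition PG :: "(nat \<Rightarrow> nat) \<Rightarrow> nat list \<Rightarrow> nat \<Rightarrow> real" where
  "PG k ys c = real (cnt k (\<lambda>\<tau>. \<forall>y\<in>set ys. \<tau> y \<noteq> c)) / real (cnt k\<^sub>0 (\<lambda>_. True))"

definition PF :: "(nat \<Rightarrow> nat) \<Rightarrow> nat list \<Rightarrow> nat \<Rightarrow> real" where
  "PF k ys c = real (cnt k (\<lambda>\<tau>. \<exists>y\<in>set ys. \<tau> y = c)) / real (cnt k\<^sub>0 (\<lambda>_. True))"

section \<open>Inclusion and exclusion along a list of neighbors\<close>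

lemma P_nonneg: "0 \<le> P k" and PG_nonneg: "0 \<le> PG k ys c" and PF_nonneg: "0 \<le> PF k ys c"
  by (simp_all add: P_def PG_def PF_def)

lemma PG_le: "PG k ys c \<le> P k" and PF_le: "PF k ys c \<le> P k"
  by (auto simp: P_def PG_def PF_def intro!: divide_right_mono cnt_mono)

lemma PG_Nil [simp]: "PG k [] c = P k" and PF_Nil [simp]: "PF k [] c = 0"
  by (auto simp: P_def PG_def PF_def cnt_def)

lemma PG_PF: "PG k ys c = P k - PF k ys c"
  using cnt_split[of k "\<lambda>_. True" "\<lambda>\<tau>. \<forall>y\<in>set ys. \<tau> y \<noteq> c"]
  by (simp add: P_def PG_def PF_def diff_divide_distrib[symmetric])

lemma PF_Cons_same:
  assumes "k y = c" "c \<noteq> 0"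
  shows "PF k (y # ys) c = P k"
  unfolding PF_def P_def using assms
  by (intro arg_cong2[where f="(/)"] arg_cong[where f=real] cnt_cong refl) (auto simp: agrees_def)

lemma PG_Cons_same: "k y = c \<Longrightarrow> c \<noteq> 0 \<Longrightarrow> PG k (y # ys) c = 0"
  by (simp add: PG_PF PF_Cons_same)

lemma PG_Cons_other: "k y \<noteq> 0 \<Longrightarrow> k y \<noteq> c \<Longrightarrow> PG k (y # ys) c = PG k ys c"
  and PF_Cons_other: "k y \<noteq> 0 \<Longrightarrow> k y \<noteq> c \<Longrightarrow> PF k (y # ys) c = PF k ys c"
  unfolding PG_def PF_def agrees_def
  by (intro arg_cong2[where f="(/)"] arg_cong[where f=real] cnt_cong; force simp: agrees_def)+

text \<open>Splitting by whether \<open>y\<close> has color \<open>c\<close>; on the colorings where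
  it has, \<open>k\<close> may be extended by that color. This is the only branching step of the
  expansion and the source of negative weights.\<close>

lemma PG_Cons_uncolored:
  assumes "k y = 0" "c \<noteq> 0"
  shows "PG k (y # ys) c = PG k ys c - PG (k(y := c)) ys c"
proof -
  have "cnt k (\<lambda>\<tau>. \<forall>z\<in>set ys. \<tau> z \<noteq> c) =
      cnt (k(y := c)) (\<lambda>\<tau>. \<forall>z\<in>set ys. \<tau> z \<noteq> c) + cnt k (\<lambda>\<tau>. \<forall>z\<in>set (y # ys). \<tau> z \<noteq> c)"
    by (subst cnt_split[where \<psi>="\<lambda>\<tau>. \<tau> y = c"])
      (intro arg_cong2[where f="(+)"] cnt_cong; auto simp: agrees_upd[of k y c, OF assms])
  then show ?thesis by (simp add: PG_def diff_divide_distrib[symmetric])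
qed

text \<open>The event is decomposed according to the last vertex of the list with color
  \<open>c\<close>. Hence the new term is again a \<open>PG\<close>, and the walk continues in mode
  0 after coloring a vertex, whatever the mode was.\<close>

lemma PF_Cons_uncolored:
  assumes "k y = 0" "c \<noteq> 0"
  shows "PF k (y # ys) c = PF k ys c + PG (k(y := c)) ys c"
  using PG_Cons_uncolored[of k y c ys, OF assms] by (simp add: PG_PF)

lemma P_resample:
  assumes "u \<in> pverts G" "k u \<in> {1..q}"
  shows "q * P k = PG (k(u := 0)) (adj u) (k u) + (\<Sum>c'\<in>{1..q}. PF k (adj u) c')"
proof -
  have "real q * real (cnt k (\<lambda>_. True)) =
    real (cnt (k(u := 0)) (\<lambda>\<tau>. \<forall>y\<in>set (adj u). \<tau> y \<noteq> k u)) +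
    (\<Sum>c'\<in>{1..q}. real (cnt k (\<lambda>\<tau>. \<exists>y\<in>set (adj u). \<tau> y = c')))"
    using arg_cong[OF cnt_resample[of u k], of real] assms by simp
  then show ?thesis
    by (simp add: P_def PG_def PF_def sum_divide_distrib[symmetric] add_divide_distrib[symmetric])
qed

text \<open>By \<open>sum_cnt_nbr_le\<close> the second term of the resampling identity is at most
  \<Delta> \<le> \<open>q / 2\<close> times the count itself and is absorbed on the left.\<close>

lemma P_le_pop:
  assumes "u \<in> pverts G" "k u \<in> {1..q}"
  shows "P k \<le> 2 / q * P (k(u := 0))"
proof -
  have "q * cnt k (\<lambda>_. True) \<le> cnt (k(u := 0)) (\<lambda>_. True) + \<Delta> * cnt k (\<lambda>_. True)"
    unfolding cnt_resample[of u k, OF assms]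
    by (intro add_mono sum_cnt_nbr_le assms cnt_mono) auto
  then have "real (q * cnt k (\<lambda>_. True)) \<le> real (cnt (k(u := 0)) (\<lambda>_. True) + \<Delta> * cnt k (\<lambda>_. True))"
    by (rule of_nat_mono)
  then have "real q * real (cnt k (\<lambda>_. True)) \<le> real (cnt (k(u := 0)) (\<lambda>_. True)) + real \<Delta> * real (cnt k (\<lambda>_. True))"
    by simp
  moreover have "real \<Delta> * real (cnt k (\<lambda>_. True)) \<le> (real q / 2) * real (cnt k (\<lambda>_. True))"
    using q_ge by (intro mult_right_mono) auto
  ultimately have "real q * real (cnt k (\<lambda>_. True)) \<le> 2 * real (cnt (k(u := 0)) (\<lambda>_. True))"
    by linarith
  then have "real (cnt k (\<lambda>_. True)) \<le> 2 / q * real (cnt (k(u := 0)) (\<lambda>_. True))"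
    using q_pos by (simp add: field_simps)
  then have "P k \<le> 2 / q * real (cnt (k(u := 0)) (\<lambda>_. True)) / real (cnt k\<^sub>0 (\<lambda>_. True))"
    unfolding P_def by (rule divide_right_mono) simp
  then show ?thesis by (simp add: P_def)
qed

text \<open>Distinctness and disjointness from \<Lambda> make the stack height equal to the number
  of vertices colored beyond \<sigma>, which is the exponent in all size bounds. The coloring need
  not be proper; then \<open>P k\<close> is just 0.\<close>

definition good :: "(nat \<Rightarrow> nat) \<Rightarrow> nat list \<Rightarrow> bool" where
  "good k st \<longleftrightarrow> distinct st \<and> set st \<subseteq> pverts G - \<Lambda> \<and> (\<forall>x\<in>set st. k x \<in> {1..q}) \<and>
     (\<forall>x. x \<notin> set st \<longrightarrow> k x = k\<^sub>0 x)"

lemma good_Nil: "good k [] \<longleftrightarrow> k = k\<^sub>0"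
  by (auto simp: good_def)

lemma good_pop: "good k (u # st) \<Longrightarrow> good (k(u := 0)) st"
  by (auto simp: good_def k\<^sub>0_def)

text \<open>Colors start at 1, so an uncolored vertex is neither on the stack nor in
  \<Lambda>.\<close>

lemma good_push:
  assumes "good k st" "k y = 0" "y \<in> pverts G" "c \<in> {1..q}"
  shows "good (k(y := c)) (y # st)"
proof -
  have "y \<notin> set st" using assms by (auto simp: good_def)
  moreover have "y \<notin> \<Lambda>"
  proof
    assume "y \<in> \<Lambda>"
    then have "k y = \<sigma> y" using assms(1) \<open>y \<notin> set st\<close> by (auto simp: good_def k\<^sub>0_def)
    then show False using \<sigma>_range[OF \<open>y \<in> \<Lambda>\<close>] assms(2) by simp
  qed
  ultimately show ?thesis using assms by (auto simp: good_def)
qed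

lemma P_k0 [simp]: "P k\<^sub>0 = 1"
  using cnt_k0_pos by (simp add: P_def)

lemma P_le: "good k st \<Longrightarrow> P k \<le> (2 / q) ^ length st"
proof (induction st arbitrary: k)
  case (Cons u st)
  then have "P k \<le> 2 / q * P (k(u := 0))" by (intro P_le_pop) (auto simp: good_def)
  also have "\<dots> \<le> 2 / q * (2 / q) ^ length st"
    by (intro mult_left_mono Cons.IH good_pop[OF Cons.prems]) simp
  finally show ?case by simp
qed (simp add: good_Nil)

text \<open>Separates colors already present on \<open>ys\<close>, for which \<open>PF\<close> may
  be as large as \<open>P k\<close>, from the others, for which it is smaller by a factor of order
  \<Delta> / q. A uniformly random color is of the first kind only with probability at most \<Delta>
  / q, by \<open>sum_hit_le\<close>.\<close>

definition hit :: "(nat \<Rightarrow> nat) \<Rightarrow> nat list \<Rightarrow> nat \<Rightarrow> real" where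
  "hit k ys c = of_bool (\<exists>y\<in>set ys. k y = c)"

lemma hit_nonneg: "0 \<le> hit k ys c" and hit_le_1: "hit k ys c \<le> 1"
  by (simp_all add: hit_def)

text \<open>Union bound over \<open>ys\<close>, with \<open>P_le\<close> for one more colored vertex
  at each uncolored neighbor.\<close>

lemma PF_bound:
  assumes "good k st" "set ys \<subseteq> pverts G" "c \<in> {1..q}"
  shows "PF k ys c \<le> (2 / q) ^ length st * (hit k ys c + length ys * (2 / q))"
  using assms(2)
proof (induction ys)
  case (Cons y ys)
  let ?p = "(2 / real q) ^ length st"
  have p: "0 \<le> ?p" by simp
  consider "k y = 0" | "k y = c" | "k y \<noteq> 0" "k y \<noteq> c" by blast
  then show ?case
  proof cases
    case 1
    have "PG (k(y := c)) ys c \<le> P (k(y := c))" by (rule PG_le)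
    also have "\<dots> \<le> (2 / q) ^ length (y # st)"
      using Cons.prems assms 1 by (intro P_le good_push) auto
    finally have "PF k (y # ys) c \<le> ?p * (hit k ys c + length ys * (2 / q)) + ?p * (2 / q)"
      using Cons 1 assms(3) by (simp add: PF_Cons_uncolored mult.commute)
    moreover have "hit k (y # ys) c = hit k ys c" using 1 assms(3) by (auto simp: hit_def)
    ultimately show ?thesis by (simp add: algebra_simps add_divide_distrib)
  next
    case 2
    then have "hit k (y # ys) c = 1" by (auto simp: hit_def)
    moreover have "PF k (y # ys) c \<le> ?p * 1"
      using PF_le P_le[OF assms(1)] by (auto intro: order_trans)
    moreover have "?p * 1 \<le> ?p * (1 + length (y # ys) * (2 / q))"
      by (intro mult_left_mono) auto
    ultimately show ?thesis by (simp only:)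
  next
    case 3
    then have "hit k (y # ys) c = hit k ys c" by (auto simp: hit_def)
    moreover have "PF k (y # ys) c = PF k ys c" using 3 by (rule PF_Cons_other)
    moreover have "?p * (hit k ys c + length ys * (2 / q)) \<le> ?p * (hit k ys c + length (y # ys) * (2 / q))"
      by (intro mult_left_mono) (auto simp: divide_right_mono)
    ultimately show ?thesis using Cons by (simp only:) auto
  qed
qed (simp add: hit_nonneg)

lemma sum_hit_le: "(\<Sum>c'\<in>{1..q}. hit k ys c') \<le> length ys"
proof -
  have "(\<Sum>c'\<in>{1..q}. hit k ys c') = real (card {c'\<in>{1..q}. \<exists>y\<in>set ys. k y = c'})"
    by (simp add: hit_def sum.If_cases of_bool_def Int_def)
  also have "card {c'\<in>{1..q}. \<exists>y\<in>set ys. k y = c'} \<le> card (k ` set ys)"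
    by (rule card_mono) auto
  also have "\<dots> \<le> length ys"
    using card_image_le[of "set ys" k] card_length[of ys] by simp
  finally show ?thesis by simp
qed

section \<open>The marginal distribution\<close>

lemma marginal_eq:
  assumes "c \<in> {1..q}"
  shows "marginal G q \<Lambda> \<sigma> v c = P (k\<^sub>0(v := c))"
proof -
  have S: "S \<noteq> {}" using cnt_k0_pos by (auto simp: cnt_def card_gt_0_iff)
  have agree: "restrict \<tau> \<Lambda> = \<sigma> \<longleftrightarrow> agrees k\<^sub>0 \<tau>" for \<tau>
  proof -
    have "restrict \<tau> \<Lambda> = \<sigma> \<longleftrightarrow> (\<forall>x\<in>\<Lambda>. \<tau> x = \<sigma> x)"
      using \<sigma> by (auto simp: partial_proper_coloring_def PiE_iff extensional_def fun_eq_iff restrict_def)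
    also have "\<dots> \<longleftrightarrow> agrees k\<^sub>0 \<tau>"
      using \<sigma>_range by (fastforce simp: agrees_def k\<^sub>0_def)
    finally show ?thesis .
  qed
  have m: "measure (measure_pmf (pmf_of_set S)) {\<tau>. agrees k \<tau>} = cnt k (\<lambda>_. True) / card S" for k
    by (simp add: measure_pmf_of_set[OF S finite_S] cnt_def Int_def)
  have "{\<tau>. \<tau> v = c \<and> agrees k\<^sub>0 \<tau>} = {\<tau>. agrees (k\<^sub>0(v := c)) \<tau>}"
    using v assms by (auto simp: agrees_upd k\<^sub>0_def)
  then show ?thesis
    using S finite_S by (simp add: marginal_def cond_prob_def agree m P_def)
qed

definition blocked :: "nat \<Rightarrow> bool" where
  "blocked c \<longleftrightarrow> (\<exists>y\<in>set (adj v). k\<^sub>0 y = c)"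

lemma P_blocked:
  assumes "c \<in> {1..q}" "blocked c"
  shows "P (k\<^sub>0(v := c)) = 0"
proof -
  obtain y where y: "(v, y) \<in> parcs G" "k\<^sub>0 y = c"
    using assms(2) v by (auto simp: blocked_def set_adj)
  have "\<not> agrees (k\<^sub>0(v := c)) \<tau>" if "\<tau> \<in> S" for \<tau>
  proof
    assume a: "agrees (k\<^sub>0(v := c)) \<tau>"
    have "\<tau> v = c" "\<tau> y = c" using a y assms(1) by (auto simp: agrees_def)
    then show False using that y(1) by (auto simp: proper_colorings_def)
  qed
  then have "cnt (k\<^sub>0(v := c)) (\<lambda>_. True) = 0" unfolding cnt_def by (metis (mono_tags, lifting) Collect_empty_eq card.empty)
  then show ?thesis by (simp add: P_def)
qed

text \<open>No neighbor has color \<open>c\<close> under \<sigma>, so by \<open>PF_bound\<close> one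
  takes it with probability at most \<open>\<Delta> * (2 / q)\<close> \<le> 2 / 65. This leaves 63 /
  65 for the first term of the resampling identity at \<open>v\<close>; the second is
  nonnegative.\<close>

lemma P_unblocked:
  assumes "c \<in> {1..q}" "\<not> blocked c"
  shows "P (k\<^sub>0(v := c)) \<ge> 63 / 65 / q"
proof -
  let ?k = "k\<^sub>0(v := c)"
  have v': "v \<in> pverts G" using v by simp
  have "k\<^sub>0 v = 0" using v by (simp add: k\<^sub>0_def)
  then have k: "?k(v := 0) = k\<^sub>0" by auto
  have "PF k\<^sub>0 (adj v) c \<le> (2 / q) ^ length ([] :: nat list) * (hit k\<^sub>0 (adj v) c + length (adj v) * (2 / q))"
    using adj_verts[OF v'] assms by (intro PF_bound) (auto simp: good_Nil)
  also have "hit k\<^sub>0 (adj v) c = 0" using assms by (auto simp: hit_def blocked_def)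
  also have "(2 / real q) ^ length ([] :: nat list) * (0 + length (adj v) * (2 / q)) \<le> \<Delta> * (2 / q)"
    using length_adj[OF v'] by (simp add: divide_right_mono)
  also have "\<dots> \<le> 2 / 65" using q_ge q_pos by (simp add: field_simps)
  finally have "PG k\<^sub>0 (adj v) c \<ge> 63 / 65" by (simp add: PG_PF)
  moreover have "q * P ?k = PG k\<^sub>0 (adj v) c + (\<Sum>c'\<in>{1..q}. PF ?k (adj v) c')"
    using P_resample[of v ?k] v' assms(1) k by simp
  moreover have "(\<Sum>c'\<in>{1..q}. PF ?k (adj v) c') \<ge> 0" by (intro sum_nonneg PF_nonneg)
  ultimately show ?thesis using q_pos by (simp add: field_simps)
qed

end

section \<open>Moments of the estimator\<close>

context coloring_instance
begin

text \<open>The walk carries a weight \<open>w\<close> and a mode: in mode 0 (1) it estimates the probability that no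
  (some) vertex of \<open>ys\<close> has color \<open>c\<close>, in mode 2 only the probability of \<open>k\<close>. If the weight gets
  multiplied by a random factor with mean \<open>mean\<close> and second moment at most \<open>moment\<close>, then \<open>quad\<close>
  bounds the expectation of \<open>\<beta> * (x + w)\<^sup>2\<close> for the final \<open>w\<close>.\<close>

definition mean :: "nat \<Rightarrow> (nat \<Rightarrow> nat) \<Rightarrow> nat list \<Rightarrow> nat \<Rightarrow> real" where
  "mean md k ys c = (if md = 0 then PG k ys c else if md = 1 then PF k ys c else P k)"

definition moment :: "nat \<Rightarrow> (nat \<Rightarrow> nat) \<Rightarrow> nat list \<Rightarrow> nat \<Rightarrow> nat \<Rightarrow> real" where
  "moment md k ys c n = ((2 / q) ^ n)\<^sup>2 *
     (if md = 0 then 1 + length ys * (5 / q)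
      else if md = 1 then hit k ys c * (1 + length ys * (5 / q)) + length ys * (5 / q)
      else 1)"

definition quad :: "real \<Rightarrow> real \<Rightarrow> real \<Rightarrow> real \<Rightarrow> real \<Rightarrow> real" where
  "quad \<beta> x w a b = \<beta> * (x\<^sup>2 + 2 * x * w * a + w\<^sup>2 * b)"

text \<open>Completing the square. The potentials live in \<open>ennreal\<close>, where a negative
  real would be truncated to 0, so every use of \<open>quad\<close> there relies on this.\<close>

lemma quad_nonneg:
  assumes "0 \<le> \<beta>" "a\<^sup>2 \<le> b"
  shows "0 \<le> quad \<beta> x w a b"
proof -
  have "0 \<le> (x + w * a)\<^sup>2" by simp
  also have "\<dots> = x\<^sup>2 + 2 * x * w * a + w\<^sup>2 * a\<^sup>2" by (simp add: power2_eq_square algebra_simps)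
  also have "\<dots> \<le> x\<^sup>2 + 2 * x * w * a + w\<^sup>2 * b"
    using assms(2) by (simp add: mult_left_mono)
  finally show ?thesis using assms(1) by (simp add: quad_def)
qed

lemma quad_mono: "0 \<le> \<beta> \<Longrightarrow> b \<le> b' \<Longrightarrow> quad \<beta> x w a b \<le> quad \<beta> x w a b'"
  by (auto simp: quad_def intro!: mult_left_mono add_left_mono)

lemma P_square_le: "good k st \<Longrightarrow> (P k)\<^sup>2 \<le> ((2 / q) ^ length st)\<^sup>2"
  by (intro power_mono P_le P_nonneg)

text \<open>Supplies the hypothesis of \<open>quad_nonneg\<close>. It cannot come from Jensen's
  inequality for the walk, whose moments are not known yet, and is read off from the size bounds on
  \<open>P\<close> and \<open>PF\<close>.\<close>

lemma mean_square_le: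
  assumes "good k st" "set ys \<subseteq> pverts G" "c \<in> {1..q}" "length ys \<le> \<Delta>"
  shows "(mean md k ys c)\<^sup>2 \<le> moment md k ys c (length st)"
proof -
  let ?p = "(2 / real q) ^ length st"
  let ?e = "real (length ys)"
  have eq: "?e * 65 \<le> q" using assms(4) q_ge by simp
  have P: "P k \<le> ?p" by (rule P_le[OF assms(1)])
  consider "md = 0" | "md = 1" | "md \<noteq> 0" "md \<noteq> 1" by blast
  then show ?thesis
  proof cases
    case 1
    have "(mean md k ys c)\<^sup>2 \<le> ?p\<^sup>2 * 1"
      using 1 P PG_le[of k ys c] PG_nonneg by (simp add: mean_def power_mono)
    also have "\<dots> \<le> ?p\<^sup>2 * (1 + ?e * (5 / q))" by (intro mult_left_mono) auto
    finally show ?thesis using 1 by (simp add: moment_def)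
  next
    case 2
    show ?thesis
    proof (cases "hit k ys c = 0")
      case True
      have "PF k ys c \<le> ?p * (?e * (2 / q))" using PF_bound[OF assms(1-3)] True by simp
      then have "(PF k ys c)\<^sup>2 \<le> (?p * (?e * (2 / q)))\<^sup>2" by (intro power_mono PF_nonneg)
      also have "\<dots> = ?p\<^sup>2 * (?e * (2 / q))\<^sup>2" by (rule power_mult_distrib)
      also have "\<dots> \<le> ?p\<^sup>2 * (?e * (5 / q))"
      proof (intro mult_left_mono)
        have "(?e * (2 / q))\<^sup>2 = ?e * (2 / q) * (?e * 2 / q)" by (simp add: power2_eq_square)
        also have "\<dots> \<le> ?e * (2 / q) * 1"
          using eq q_pos by (intro mult_left_mono) (auto simp: field_simps)
        also have "\<dots> \<le> ?e * (5 / q)" by (auto intro!: mult_left_mono divide_right_mono)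
        finally show "(?e * (2 / q))\<^sup>2 \<le> ?e * (5 / q)" .
      qed simp
      finally show ?thesis using 2 True by (simp add: mean_def moment_def)
    next
      case False
      then have h: "hit k ys c = 1" by (auto simp: hit_def)
      have "(PF k ys c)\<^sup>2 \<le> ?p\<^sup>2 * 1"
        using P PF_le[of k ys c] PF_nonneg by (simp add: power_mono)
      also have "\<dots> \<le> ?p\<^sup>2 * (hit k ys c * (1 + ?e * (5 / q)) + ?e * (5 / q))"
        by (intro mult_left_mono) (auto simp: h)
      finally show ?thesis using 2 by (simp add: mean_def moment_def)
    qed
  next
    case 3
    then show ?thesis using P_square_le[OF assms(1)] by (simp add: mean_def moment_def)
  qed
qed

text \<open>A neighbor that already has color \<open>c\<close> settles the event: in mode 1 it is
  certain, and mode 2 follows; in mode 0 it is impossible, the weight becomes 0, and any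
  \<open>a\<close> and \<open>b\<close> will do for the continuation.\<close>

lemma quad_same_color:
  assumes "0 \<le> \<beta>" "k y = c" "c \<noteq> 0"
  shows "quad \<beta> x w (mean 2 k ys c) (moment 2 k ys c n) \<le>
           quad \<beta> x w (mean 1 k (y # ys) c) (moment 1 k (y # ys) c n)"
    and "quad \<beta> x 0 a b \<le> quad \<beta> x w (mean 0 k (y # ys) c) (moment 0 k (y # ys) c n)"
proof -
  have "hit k (y # ys) c = 1" using assms by (simp add: hit_def)
  then have "moment 2 k ys c n \<le> moment 1 k (y # ys) c n"
    unfolding moment_def by (intro mult_left_mono) auto
  then show "quad \<beta> x w (mean 2 k ys c) (moment 2 k ys c n) \<le>
           quad \<beta> x w (mean 1 k (y # ys) c) (moment 1 k (y # ys) c n)"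
    using assms by (simp add: mean_def PF_Cons_same quad_mono)
  have "0 \<le> moment 0 k (y # ys) c n" by (simp add: moment_def)
  then show "quad \<beta> x 0 a b \<le> quad \<beta> x w (mean 0 k (y # ys) c) (moment 0 k (y # ys) c n)"
    using assms by (auto simp: mean_def PG_Cons_same quad_def intro!: mult_left_mono)
qed

lemma quad_other_color:
  assumes "0 \<le> \<beta>" "k y \<noteq> c" "k y \<noteq> 0" "md < 2"
  shows "quad \<beta> x w (mean md k ys c) (moment md k ys c n) \<le>
           quad \<beta> x w (mean md k (y # ys) c) (moment md k (y # ys) c n)"
proof -
  have m: "mean md k (y # ys) c = mean md k ys c"
    using assms by (simp add: mean_def PG_Cons_other PF_Cons_other)
  have h: "hit k (y # ys) c = hit k ys c" using assms by (simp add: hit_def)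
  have l: "real (length ys) * (5 / q) \<le> real (length (y # ys)) * (5 / q)"
    by (intro mult_right_mono) auto
  have "moment md k ys c n \<le> moment md k (y # ys) c n"
    unfolding moment_def h using assms(4) l
    by (intro mult_left_mono) (auto intro!: add_mono mult_left_mono simp: hit_nonneg simp del: length_Cons)
  then show ?thesis using assms by (simp add: m quad_mono)
qed

text \<open>Importance sampling: each branch divides the weight by its probability, with sign -1 in
  mode 0 and +1 in mode 1 on the branch that colors \<open>y\<close>. Constant and linear terms
  match exactly. In the second moment the coloring branch contributes
  \<open>2 / q * (q / 2)\<^sup>2 * (2 / q)\<^sup>2 = 2 / q\<close>, and the other branch inflates by
  \<open>q / (q - 2)\<close>, about \<open>1 + 2 / q\<close>. The loss of about \<open>4 / q\<close>
  per neighbor is covered by the allowance \<open>5 / q\<close> in \<open>moment\<close>.\<close>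

lemma quad_uncolored:
  fixes w :: real
  assumes "0 \<le> \<beta>" "k y = 0" "c \<noteq> 0" "md < 2" "length (y # ys) \<le> \<Delta>"
  shows "2 / q * quad \<beta> x (w * q * (2 * real md - 1) / 2)
             (mean 0 (k(y := c)) ys c) (moment 0 (k(y := c)) ys c (Suc n)) +
           (1 - 2 / q) * quad \<beta> x (w * q / (real q - 2)) (mean md k ys c) (moment md k ys c n)
         \<le> quad \<beta> x w (mean md k (y # ys) c) (moment md k (y # ys) c n)"
proof -
  define e where "e = real (length ys)"
  define Q where "Q = real q"
  define p where "p = ((2 / Q) ^ n)\<^sup>2"
  define s where "s = 2 * real md - 1"
  define A where "A = mean 0 (k(y := c)) ys c"
  define M where "M = mean md k ys c"
  define h where "h = hit k ys c"
  define B where "B = (if md = 0 then 1 + e * (5 / Q) else h * (1 + e * (5 / Q)) + e * (5 / Q))"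
  define B' where "B' = (if md = 0 then 1 + (e + 1) * (5 / Q) else h * (1 + (e + 1) * (5 / Q)) + (e + 1) * (5 / Q))"
  have Q: "65 \<le> Q" using q_pos by (simp add: Q_def)
  have e: "0 \<le> e" "65 * (e + 1) \<le> Q" using assms(5) q_ge by (simp_all add: e_def Q_def)
  have h: "0 \<le> h" "h \<le> 1" by (simp_all add: h_def hit_nonneg hit_le_1)
  have p: "0 \<le> p" by (simp add: p_def)
  have s2: "s * s = 1" using assms(4) by (cases md) (auto simp: s_def)
  have mean: "mean md k (y # ys) c = M + s * A"
    using assms by (cases md) (auto simp: mean_def M_def A_def s_def PG_Cons_uncolored PF_Cons_uncolored)
  have mom0: "moment 0 (k(y := c)) ys c (Suc n) = p * (2 / Q)\<^sup>2 * (1 + e * (5 / Q))"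
    unfolding moment_def p_def Q_def e_def power_Suc2 power_mult_distrib by simp
  have mom: "moment md k ys c n = p * B"
    using assms(4) by (simp add: moment_def p_def Q_def e_def B_def h_def)
  have "hit k (y # ys) c = h" using assms by (simp add: h_def hit_def)
  then have mom': "moment md k (y # ys) c n = p * B'"
    using assms(4) by (simp add: moment_def p_def Q_def e_def B'_def add.commute)
  \<comment> \<open>The lower-order factors are 14 / 13, which bounds \<open>1 + e * (5 / Q)\<close>
    as \<open>65 * e \<le> Q\<close>, and 65 / 63, which bounds \<open>Q / (Q - 2)\<close> as
    \<open>65 \<le> Q\<close>.\<close>
  have key: "2 / Q * (1 + e * (5 / Q)) + Q / (Q - 2) * B \<le> B'"
  proof -
    define b where "b = 5 / Q"
    define r where "r = 2 / (Q - 2)"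
    have b: "0 \<le> b" "e * b \<le> 1 / 13" "2 / Q = 2 / 5 * b" using e Q by (auto simp: b_def field_simps)
    have r: "Q / (Q - 2) = 1 + r" "0 \<le> r" "r \<le> 65 / 63 * (2 / 5) * b" using Q by (auto simp: r_def b_def field_simps)
    have eb: "0 \<le> e * b" using e b by simp
    have 1: "2 / 5 * b * (1 + e * b) \<le> 2 / 5 * b * (14 / 13)"
      using b by (intro mult_left_mono) auto
    have 2: "r * (1 + e * b) \<le> 65 / 63 * (2 / 5) * b * (14 / 13)"
      using b r eb by (intro mult_mono) auto
    have 3: "r * (e * b) \<le> 65 / 63 * (2 / 5) * b * (1 / 13)"
      using b r eb by (intro mult_mono) auto
    have 4: "h * (r * (1 + e * b)) \<le> h * b" 
      using h 2 b by (intro mult_left_mono) auto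
    show ?thesis
    proof (cases "md = 0")
      case True
      have "2 / 5 * b * (1 + e * b) + r * (1 + e * b) \<le> b" using 1 2 b(1) by linarith
      then show ?thesis using True unfolding B_def B'_def b_def[symmetric] b(3) r(1)
        by (simp add: algebra_simps)
    next
      case False
      have "2 / 5 * b * (1 + e * b) + r * (e * b) \<le> b" using 1 3 b(1) by linarith
      then show ?thesis using False 4 unfolding B_def B'_def b_def[symmetric] b(3) r(1)
        by (simp add: algebra_simps)
    qed
  qed
  have "2 / Q * quad \<beta> x (w * Q * s / 2) A (p * (2 / Q)\<^sup>2 * (1 + e * (5 / Q))) +
        (1 - 2 / Q) * quad \<beta> x (w * Q / (Q - 2)) M (p * B)
      = \<beta> * (x\<^sup>2 + 2 * x * w * (M + s * A) + w\<^sup>2 * (p * (2 / Q * (1 + e * (5 / Q)) * (s * s) + Q / (Q - 2) * B)))"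
  proof -
    have 1: "2 / Q * quad \<beta> x (w * Q * s / 2) A (p * (2 / Q)\<^sup>2 * (1 + e * (5 / Q))) =
       \<beta> * (2 / Q * x\<^sup>2 + 2 * x * w * (s * A) + w\<^sup>2 * (p * (2 / Q * (1 + e * (5 / Q)) * (s * s))))"
      using Q unfolding quad_def power2_eq_square by (simp add: field_simps)
    have 2: "(1 - 2 / Q) * quad \<beta> x (w * Q / (Q - 2)) M (p * B) =
       \<beta> * ((1 - 2 / Q) * x\<^sup>2 + 2 * x * w * M + w\<^sup>2 * (p * (Q / (Q - 2) * B)))"
    proof -
      define z where "z = Q / (Q - 2)"
      have z: "(1 - 2 / Q) * z = 1" using Q by (simp add: z_def field_simps)
      have w: "w * Q / (Q - 2) = w * z" by (simp add: z_def)
      have "(1 - 2 / Q) * quad \<beta> x (w * z) M (p * B) =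
        \<beta> * ((1 - 2 / Q) * x\<^sup>2 + 2 * x * w * M * ((1 - 2 / Q) * z) + w\<^sup>2 * (p * (z * B)) * ((1 - 2 / Q) * z))"
        unfolding quad_def power2_eq_square by (simp only: algebra_simps)
      then show ?thesis unfolding w z z_def[symmetric] by simp
    qed
    show ?thesis unfolding 1 2 by (simp add: algebra_simps)
  qed
  also have "\<dots> \<le> quad \<beta> x w (M + s * A) (p * B')"
    unfolding quad_def s2 using key p assms(1) by (intro mult_left_mono add_left_mono) auto
  finally show ?thesis
    unfolding mean mom0 mom mom' A_def[symmetric] M_def[symmetric] Q_def[symmetric] s_def[symmetric] .
qed

text \<open>A fair coin picks one of the two terms of \<open>P_resample\<close>, hence the factors
  2; the sum over colors is sampled uniformly, which cancels its \<open>1 / q\<close>. The first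
  branch contributes about half of the permitted second moment. The second has the factor 4 from the
  doubled weight, but a random color is rarely present around \<open>u\<close>.\<close>

lemma quad_walk:
  fixes w :: real
  assumes "0 \<le> \<beta>" "good k (u # st)"
  shows "1 / 2 * quad \<beta> x (w * 2 / q) (mean 0 (k(u := 0)) (adj u) (k u))
            (moment 0 (k(u := 0)) (adj u) (k u) (length st)) +
         1 / 2 * ((\<Sum>c'\<in>{1..q}. quad \<beta> x (w * 2) (mean 1 k (adj u) c')
            (moment 1 k (adj u) c' (length (u # st)))) / q)
       \<le> quad \<beta> x w (P k) (((2 / q) ^ length (u # st))\<^sup>2)"
proof -
  define e where "e = real (length (adj u))"
  define Q where "Q = real q"
  define n where "n = length st"
  define p where "p = ((2 / Q) ^ Suc n)\<^sup>2"
  define A where "A = PG (k(u := 0)) (adj u) (k u)"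
  define F where "F = (\<Sum>c'\<in>{1..q}. PF k (adj u) c')"
  define H where "H = (\<Sum>c'\<in>{1..q}. hit k (adj u) c')"
  have u: "u \<in> pverts G" "k u \<in> {1..q}" using assms(2) by (auto simp: good_def)
  have Q: "65 \<le> Q" using q_pos by (simp add: Q_def)
  have e: "0 \<le> e" "65 * e \<le> Q" using length_adj[OF u(1)] q_ge by (simp_all add: e_def Q_def)
  have p: "0 \<le> p" by (simp add: p_def)
  have H: "H \<le> e" unfolding H_def e_def by (rule sum_hit_le)
  have PA: "Q * P k = A + F" unfolding Q_def A_def F_def by (rule P_resample[of u k, OF u])
  have pn: "((2 / Q) ^ n)\<^sup>2 = p * (Q / 2)\<^sup>2"
    using Q by (simp add: p_def power_mult_distrib power_divide)
  have 1: "quad \<beta> x (w * 2 / Q) (mean 0 (k(u := 0)) (adj u) (k u)) (moment 0 (k(u := 0)) (adj u) (k u) n)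
     = \<beta> * (x\<^sup>2 + 2 * x * w * (2 * A / Q) + w\<^sup>2 * (p * (1 + e * (5 / Q))))"
  proof -
    have "moment 0 (k(u := 0)) (adj u) (k u) n = p * (Q / 2)\<^sup>2 * (1 + e * (5 / Q))"
      unfolding moment_def e_def Q_def[symmetric] pn by simp
    moreover have "(w * 2 / Q)\<^sup>2 * (Q / 2)\<^sup>2 = w\<^sup>2"
      using Q by (simp add: power2_eq_square)
    then have "(w * 2 / Q)\<^sup>2 * (p * (Q / 2)\<^sup>2 * (1 + e * (5 / Q))) = w\<^sup>2 * (p * (1 + e * (5 / Q)))"
      by (metis mult.assoc mult.commute)
    ultimately have "(w * 2 / Q)\<^sup>2 * moment 0 (k(u := 0)) (adj u) (k u) n = w\<^sup>2 * (p * (1 + e * (5 / Q)))"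
      by (simp only:)
    then show ?thesis unfolding quad_def by (simp only: mean_def A_def if_True) simp
  qed
  have "(\<Sum>c'\<in>{1..q}. quad \<beta> x (w * 2) (mean 1 k (adj u) c') (moment 1 k (adj u) c' (Suc n)))
     = (\<Sum>c'\<in>{1..q}. \<beta> * x\<^sup>2 + \<beta> * (4 * x * w) * PF k (adj u) c'
          + \<beta> * (4 * w\<^sup>2 * p) * (1 + e * (5 / Q)) * hit k (adj u) c' + \<beta> * (4 * w\<^sup>2 * p) * (e * (5 / Q)))"
    by (intro sum.cong refl)
      (simp add: quad_def mean_def moment_def e_def Q_def p_def power_mult_distrib algebra_simps)
  also have "\<dots> = Q * (\<beta> * x\<^sup>2) + \<beta> * (4 * x * w) * F + \<beta> * (4 * w\<^sup>2 * p) * (1 + e * (5 / Q)) * H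
      + Q * (\<beta> * (4 * w\<^sup>2 * p) * (e * (5 / Q)))"
    by (simp only: sum.distrib sum_distrib_left[symmetric] F_def H_def) (simp add: Q_def)
  finally have "(\<Sum>c'\<in>{1..q}. quad \<beta> x (w * 2) (mean 1 k (adj u) c') (moment 1 k (adj u) c' (Suc n))) / Q
     = \<beta> * (x\<^sup>2 + 2 * x * w * (2 * F / Q) + w\<^sup>2 * (p * (4 * ((1 + e * (5 / Q)) * H / Q + e * (5 / Q)))))"
    using Q by (simp add: field_simps)
  with 1 have "1 / 2 * quad \<beta> x (w * 2 / Q) (mean 0 (k(u := 0)) (adj u) (k u)) (moment 0 (k(u := 0)) (adj u) (k u) n)
     + 1 / 2 * ((\<Sum>c'\<in>{1..q}. quad \<beta> x (w * 2) (mean 1 k (adj u) c') (moment 1 k (adj u) c' (Suc n))) / Q)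
     = \<beta> * (x\<^sup>2 + 2 * x * w * ((A + F) / Q) + w\<^sup>2 * (p * (1 / 2 * (1 + e * (5 / Q)) + 2 * ((1 + e * (5 / Q)) * H / Q + e * (5 / Q)))))"
    by (simp add: algebra_simps add_divide_distrib)
  also have "\<dots> \<le> quad \<beta> x w ((A + F) / Q) p"
  proof -
    have b: "e * (5 / Q) \<le> 1 / 13" using e Q by (simp add: field_simps)
    have "H / Q \<le> e / Q" using H Q by (intro divide_right_mono) auto
    also have "\<dots> \<le> 1 / 65" using e Q by (simp add: field_simps)
    finally have HQ: "H / Q \<le> 1 / 65" .
    have "0 \<le> H" unfolding H_def by (intro sum_nonneg hit_nonneg)
    then have "(1 + e * (5 / Q)) * (H / Q) \<le> (14 / 13) * (1 / 65)"
      using b HQ Q e by (intro mult_mono) auto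
    \<comment> \<open>The left side is at most 7 / 13 + 2 * (14 / 845 + 1 / 13), which is below 3 /
      4.\<close>
    then have "1 / 2 * (1 + e * (5 / Q)) + 2 * ((1 + e * (5 / Q)) * H / Q + e * (5 / Q)) \<le> 1"
      using b by (simp add: distrib_right add_divide_distrib)
    from mult_left_mono[OF this p]
    have "p * (1 / 2 * (1 + e * (5 / Q)) + 2 * ((1 + e * (5 / Q)) * H / Q + e * (5 / Q))) \<le> p" by simp
    then show ?thesis unfolding quad_def using assms(1) by (intro mult_left_mono add_left_mono) auto
  qed
  also have "(A + F) / Q = P k" using PA Q by (simp add: field_simps)
  finally show ?thesis by (simp only: n_def p_def Q_def length_Cons)
qed

end

section \<open>The estimator as a program\<close>

lemma nats_nset [simp]: "nats (nset x i n s) = (nats s)(x := (nats s x)(i := n))"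
  and reals_nset [simp]: "reals (nset x i n s) = reals s"
  and nats_rset [simp]: "nats (rset x i r s) = nats s"
  and reals_rset [simp]: "reals (rset x i r s) = (reals s)(x := (reals s x)(i := r))"
  by (simp_all add: nset_def rset_def)

lemma ert_Seq: "ert adj k (Seq p1 p2) f = ert adj k p1 (ert adj k p2 f)"
  by (rule ext) simp

lemma ert_Rand_le:
  assumes "\<And>r. r \<le> nval a s \<Longrightarrow> f (nset x (nval i s) r s) \<le> ennreal (g r)"
    and "\<And>r. r \<le> nval a s \<Longrightarrow> 0 \<le> g r"
  shows "ert adj k (Rand x i a) f s \<le> k + ennreal ((\<Sum>r\<le>nval a s. g r) / real (nval a s + 1))"
proof -
  let ?n = "nval a s"
  have "(\<integral>\<^sup>+ r. f (nset x (nval i s) r s) \<partial>measure_spmf (spmf_of_set {0..?n}))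
      = (\<integral>\<^sup>+ r. f (nset x (nval i s) r s) \<partial>measure_pmf (pmf_of_set {0..?n}))"
    by (simp add: spmf_of_set_def del: spmf_of_pmf_pmf_of_set)
  also have "\<dots> = (\<Sum>r\<in>{0..?n}. f (nset x (nval i s) r s)) / of_nat (card {0..?n})"
    by (rule nn_integral_pmf_of_set) simp_all
  also have "\<dots> \<le> (\<Sum>r\<in>{0..?n}. ennreal (g r)) / of_nat (card {0..?n})"
    using assms(1) by (intro divide_right_mono_ennreal sum_mono) simp
  also have "(\<Sum>r\<in>{0..?n}. ennreal (g r)) = ennreal (\<Sum>r\<in>{0..?n}. g r)"
    using assms(2) by (intro sum_ennreal) simp
  also have "\<dots> / of_nat (card {0..?n}) = ennreal ((\<Sum>r\<le>?n. g r) / real (?n + 1))"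
    using assms(2)
    by (subst divide_ennreal[symmetric])
      (auto simp: ennreal_of_nat_eq_real_of_nat atLeast0AtMost intro!: sum_nonneg simp del: of_nat_Suc)
  finally show ?thesis by (simp add: add_left_mono)
qed

text \<open>Under \<open>ert\<close>, straight-line code unfolds to repeated additions of \<kappa>
  in \<open>ennreal\<close>. Written as a power of \<open>(+)\<close>, they are compared in the
  reals in one step.\<close>

lemma add_costs_le:
  assumes "X \<le> ennreal a" "0 \<le> a" "0 \<le> \<kappa>" "a + real n * \<kappa> \<le> b"
  shows "((+) (ennreal \<kappa>) ^^ n) X \<le> ennreal b"
  using assms
proof (induction n arbitrary: b)
  case 0
  then show ?case by (auto intro: order_trans ennreal_leI)
next
  case (Suc n)
  have "((+) (ennreal \<kappa>) ^^ n) X \<le> ennreal (a + real n * \<kappa>)"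
    by (rule Suc.IH[OF Suc.prems(1-3) order_refl])
  then have "((+) (ennreal \<kappa>) ^^ Suc n) X \<le> ennreal \<kappa> + ennreal (a + real n * \<kappa>)"
    by (simp add: add_left_mono)
  also have "\<dots> = ennreal (\<kappa> + (a + real n * \<kappa>))" using Suc by (simp add: ennreal_plus)
  also have "\<dots> \<le> ennreal b" using Suc by (intro ennreal_leI) (simp add: algebra_simps)
  finally show ?case .
qed

lemma funpow_numerals:
  "(f ^^ 2) x = f (f x)" "(f ^^ 3) x = f (f (f x))" "(f ^^ 4) x = f (f (f (f x)))"
  "(f ^^ 5) x = f (f (f (f (f x))))" "(f ^^ 6) x = f (f (f (f (f (f x)))))"
  by (simp_all add: eval_nat_numeral)

lemma sum_if_less_2:
  fixes a b :: real
  shows "2 \<le> n \<Longrightarrow> (\<Sum>r\<le>n - 1. if r < 2 then a else b) = 2 * a + (real n - 2) * b"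
proof -
  assume n: "2 \<le> n"
  have "(\<Sum>r\<le>n - 1. if r < 2 then a else b) = (\<Sum>r<n. if r < 2 then a else b)"
    using n by (intro sum.cong) auto
  also have "\<dots> = (\<Sum>r\<in>{0..<2::nat}. a) + (\<Sum>r\<in>{2..<n}. b)"
    using n unfolding lessThan_atLeast0 by (subst sum.atLeastLessThan_concat[of 0 2 n, symmetric]) auto
  finally show ?thesis using n by (simp add: of_nat_diff)
qed

text \<open>Natural number arrays: 0 to 2 the input, 3 the current partial coloring, 4 the stack of the
  vertices colored in addition to \<open>\<Lambda>\<close>, 14 the colors of the neighbors of \<open>v\<close>. Variables: 5 stack
  height, 6 current vertex, 7 color, 8 mode, 9 neighbor number, 10 answer to a probe, 11 random
  bits, 12 and 13 loop counters. Real arrays: 0 the input, 1 the output; variables: 2 weight of the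
  walk, 3 sum of the samples.\<close>

abbreviation var :: "nat \<Rightarrow> nexp" where "var x \<equiv> NGet x (Const 0)"
abbreviation rvar :: "nat \<Rightarrow> rexp" where "rvar x \<equiv> RGet x (Const 0)"
abbreviation nat_eq :: "nexp \<Rightarrow> nexp \<Rightarrow> bexp" where
  "nat_eq a b \<equiv> BAnd (BNot (NLess a b)) (BNot (NLess b a))"
abbreviation seq (infixr ";;" 60) where "p1 ;; p2 \<equiv> Seq p1 p2"
abbreviation neighbor :: nexp where "neighbor \<equiv> NMinus (var 10) (Const 1)"
abbreviation num_colors :: nexp where "num_colors \<equiv> var 0"

text \<open>Answer 0 means that the adjacency list is exhausted. Mode 2 leaves early because its
  mean \<open>P k\<close> does not depend on the remaining neighbors.\<close>

definition nbr_guard :: bexp where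
  "nbr_guard = BAnd (NLess (Const 0) (var 10)) (NLess (var 8) (Const 2))"

text \<open>The sign \<open>2 * md - 1\<close> is computed in the reals, since subtraction of
  natural numbers truncates.\<close>

definition nbr_push :: com where
  "nbr_push =
     NSet 3 neighbor (var 7) ;;
     NSet 4 (var 5) neighbor ;;
     NSet 5 (Const 0) (NPlus (var 5) (Const 1)) ;;
     RSet 2 (Const 0) (RDivide (RTimes (RTimes (rvar 2) (OfNat num_colors))
       (RMinus (OfNat (NPlus (var 8) (var 8))) (OfNat (Const 1)))) (OfNat (Const 2))) ;;
     NSet 8 (Const 0) (Const 0)"

definition nbr_skip :: com where
  "nbr_skip = RSet 2 (Const 0) (RDivide (RTimes (rvar 2) (OfNat num_colors))
     (RMinus (OfNat num_colors) (OfNat (Const 2))))"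

definition nbr_colored :: com where
  "nbr_colored =
     Cond (nat_eq (NGet 3 neighbor) (var 7))
       (Cond (NLess (Const 0) (var 8))
         (NSet 8 (Const 0) (Const 2))
         (RSet 2 (Const 0) (OfNat (Const 0))))
       Skip"

definition nbr_uncolored :: com where
  "nbr_uncolored =
     Rand 11 (Const 0) (NMinus num_colors (Const 1)) ;;
     Cond (NLess (var 11) (Const 2)) nbr_push nbr_skip"

definition nbr_next :: com where
  "nbr_next =
     NSet 9 (Const 0) (NPlus (var 9) (Const 1)) ;;
     Probe 10 (Const 0) (var 6) (var 9)"

definition nbr_body :: com where
  "nbr_body = Cond (NLess (Const 0) (NGet 3 neighbor)) nbr_colored nbr_uncolored ;; nbr_next"

definition walk_pop :: com where
  "walk_pop =
     NSet 7 (Const 0) (NGet 3 (var 6)) ;;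
     NSet 3 (var 6) (Const 0) ;;
     NSet 5 (Const 0) (NMinus (var 5) (Const 1)) ;;
     RSet 2 (Const 0) (RDivide (RTimes (rvar 2) (OfNat (Const 2))) (OfNat num_colors)) ;;
     NSet 8 (Const 0) (Const 0)"

definition walk_recolor :: com where
  "walk_recolor =
     NSet 7 (Const 0) (NPlus (var 7) (Const 1)) ;;
     RSet 2 (Const 0) (RTimes (rvar 2) (OfNat (Const 2))) ;;
     NSet 8 (Const 0) (Const 1)"

text \<open>\<open>Rand\<close> draws from 0 to \<open>q - 1\<close>; \<open>walk_recolor\<close>
  shifts this to a color.\<close>

definition walk_keep :: com where
  "walk_keep = Rand 7 (Const 0) (NMinus num_colors (Const 1)) ;; walk_recolor"

text \<open>Ending in mode 1 means that no neighbor settled the event, and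
  \<open>PF k [] c = 0\<close>.\<close>

definition walk_end :: com where
  "walk_end = Cond (nat_eq (var 8) (Const 1)) (RSet 2 (Const 0) (OfNat (Const 0))) Skip"

definition walk_nbrs :: com where
  "walk_nbrs =
     NSet 9 (Const 0) (Const 0) ;;
     Probe 10 (Const 0) (var 6) (var 9) ;;
     While nbr_guard nbr_body ;;
     walk_end"

definition walk_guard :: bexp where
  "walk_guard = NLess (Const 0) (var 5)"

definition walk_body :: com where
  "walk_body =
     NSet 6 (Const 0) (NGet 4 (NMinus (var 5) (Const 1))) ;;
     Rand 11 (Const 0) (Const 1) ;;
     Cond (NLess (var 11) (Const 1)) walk_pop walk_keep ;;
     walk_nbrs"

definition stack :: "state \<Rightarrow> nat list" where
  "stack s = rev (map (nats s 4) [0..<nats s 5 0])"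

lemma length_stack [simp]: "length (stack s) = nats s 5 0"
  by (simp add: stack_def)

lemma stack_push:
  "nats s' 4 = (nats s 4)(nats s 5 0 := y) \<Longrightarrow> nats s' 5 0 = Suc (nats s 5 0) \<Longrightarrow> stack s' = y # stack s"
  by (simp add: stack_def)

lemma stack_pop:
  "0 < nats s 5 0 \<Longrightarrow> nats s' 4 = nats s 4 \<Longrightarrow> nats s' 5 0 = nats s 5 0 - 1 \<Longrightarrow>
     stack s = nats s 4 (nats s 5 0 - 1) # stack s'"
  by (cases "nats s 5 0") (simp_all add: stack_def)

lemma stack_cong: "nats s' 4 = nats s 4 \<Longrightarrow> nats s' 5 0 = nats s 5 0 \<Longrightarrow> stack s' = stack s"
  by (simp add: stack_def)

text \<open>The part of the memory that the walk does not change.\<close>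

definition frame :: "state \<Rightarrow> _" where
  "frame s = (nats s 0, nats s 12, nats s 13, nats s 14, reals s 0, reals s 1, reals s 3)"

context coloring_instance
begin

section \<open>Potentials of the walk and of its loop over neighbors\<close>

definition nbr_inv :: "_ \<Rightarrow> state \<Rightarrow> bool" where
  "nbr_inv F s \<longleftrightarrow> nats s 0 0 = q \<and> frame s = F \<and> good (nats s 3) (stack s) \<and>
     nats s 6 0 \<in> pverts G \<and> nats s 7 0 \<in> {1..q} \<and> nats s 8 0 \<le> 2"

text \<open>The 15 units per remaining neighbor pay for its iteration and for the expected growth of
  the stack term, at most \<open>2 / q * (100 * \<Delta>)\<close> \<le> 200 / 65.\<close>

definition nbr_val :: "real \<Rightarrow> real \<Rightarrow> real \<Rightarrow> state \<Rightarrow> nat list \<Rightarrow> real \<Rightarrow> real" where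
  "nbr_val \<beta> x \<kappa> s ys t =
     quad \<beta> x (reals s 2 0) (mean (nats s 8 0) (nats s 3) ys (nats s 7 0))
       (moment (nats s 8 0) (nats s 3) ys (nats s 7 0) (nats s 5 0)) +
     \<kappa> * (15 * real (length ys) + 100 * real \<Delta> * real (nats s 5 0) + t)"

text \<open>The final 4 units are the failing guard, two for \<open>walk_end\<close>, and the 1 in
  \<open>walk_val\<close>.\<close>

definition nbr_pot where
  "nbr_pot \<beta> x \<kappa> F s =
     (if nbr_inv F s \<and> nats s 10 0 = probe adj (nats s 6 0) (nats s 9 0)
      then ennreal (nbr_val \<beta> x \<kappa> s (drop (nats s 9 0) (adj (nats s 6 0))) 4) else \<top>)"

definition walk_inv :: "_ \<Rightarrow> state \<Rightarrow> bool" where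
  "walk_inv F s \<longleftrightarrow> nats s 0 0 = q \<and> frame s = F \<and> good (nats s 3) (stack s)"

text \<open>The drift argument: an entry leaves the stack with probability 1 / 2, while the
  neighbors add at most \<open>2 * \<Delta> / q\<close> entries on average. The expected release of
  \<open>50 * \<Delta>\<close> pays for \<open>15 * \<Delta>\<close> units of neighbor processing
  and for constants. The last unit is the final guard.\<close>

definition walk_val :: "real \<Rightarrow> real \<Rightarrow> real \<Rightarrow> state \<Rightarrow> real" where
  "walk_val \<beta> x \<kappa> s =
     quad \<beta> x (reals s 2 0) (P (nats s 3)) (((2 / q) ^ nats s 5 0)\<^sup>2) + \<kappa> * (100 * real \<Delta> * real (nats s 5 0) + 1)"

definition walk_pot where
  "walk_pot \<beta> x \<kappa> F s = (if walk_inv F s then ennreal (walk_val \<beta> x \<kappa> s) else \<top>)"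

context
  fixes \<beta> \<kappa> :: real
  assumes \<beta>: "0 \<le> \<beta>" and \<kappa>: "0 \<le> \<kappa>"
begin

lemma nbr_val_nonneg:
  assumes "nbr_inv F s" "set ys \<subseteq> pverts G" "length ys \<le> \<Delta>" "0 \<le> t"
  shows "0 \<le> nbr_val \<beta> x \<kappa> s ys t"
  unfolding nbr_val_def
  using assms \<beta> \<kappa> mean_square_le[of "nats s 3" "stack s" ys "nats s 7 0" "nats s 8 0"]
  by (intro add_nonneg_nonneg quad_nonneg mult_nonneg_nonneg) (auto simp: nbr_inv_def)

lemma drop_adj:
  assumes "u \<in> pverts G"
  shows "set (drop j (adj u)) \<subseteq> pverts G" "length (drop j (adj u)) \<le> \<Delta>"
  using adj_verts[OF assms] length_adj[OF assms] set_drop_subset[of j "adj u"] by auto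

lemma ert_nbr_next:
  assumes "nbr_inv F s"
  shows "ert adj \<kappa> nbr_next (nbr_pot \<beta> x \<kappa> F) s \<le>
    ennreal (nbr_val \<beta> x \<kappa> s (drop (Suc (nats s 9 0)) (adj (nats s 6 0))) 6)"
proof -
  let ?ys = "drop (Suc (nats s 9 0)) (adj (nats s 6 0))"
  let ?s1 = "nset 9 0 (Suc (nats s 9 0)) s"
  let ?s2 = "nset 10 0 (probe adj (nats s 6 0) (Suc (nats s 9 0))) ?s1"
  have "stack ?s2 = stack s" "frame ?s2 = frame s" by (auto intro!: stack_cong simp: frame_def)
  then have "nbr_pot \<beta> x \<kappa> F ?s2 = ennreal (nbr_val \<beta> x \<kappa> s ?ys 4)"
    using assms by (simp add: nbr_pot_def nbr_inv_def nbr_val_def)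
  then have "ert adj \<kappa> nbr_next (nbr_pot \<beta> x \<kappa> F) s = ((+) (ennreal \<kappa>) ^^ 2) (ennreal (nbr_val \<beta> x \<kappa> s ?ys 4))"
    by (simp add: nbr_next_def funpow_numerals)
  also have "\<dots> \<le> ennreal (nbr_val \<beta> x \<kappa> s ?ys 6)"
    using assms \<kappa>
    by (intro add_costs_le[OF order_refl] nbr_val_nonneg[OF assms] drop_adj)
      (auto simp: nbr_inv_def nbr_val_def algebra_simps)
  finally show ?thesis .
qed

lemma ert_nbr_body:
  assumes inv: "nbr_inv F s" and x: "nats s 10 0 = probe adj (nats s 6 0) (nats s 9 0)"
    and guard: "bval nbr_guard s"
  shows "\<kappa> + ert adj \<kappa> nbr_body (nbr_pot \<beta> x' \<kappa> F) s \<le>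
    ennreal (nbr_val \<beta> x' \<kappa> s (drop (nats s 9 0) (adj (nats s 6 0))) 4)"
proof -
  define u where "u = nats s 6 0"
  define j where "j = nats s 9 0"
  define c where "c = nats s 7 0"
  define md where "md = nats s 8 0"
  define k where "k = nats s 3"
  define n where "n = nats s 5 0"
  define w where "w = reals s 2 0"
  define ys where "ys = drop (Suc j) (adj u)"
  define y where "y = adj u ! j"
  let ?R = "ert adj \<kappa> nbr_next (nbr_pot \<beta> x' \<kappa> F)"
  have md: "md < 2" and j: "j < length (adj u)"
    using guard x by (auto simp: nbr_guard_def md_def probe_def u_def j_def split: if_splits)
  have x10: "nats s 10 0 = Suc y" using x j by (simp add: probe_def u_def j_def y_def)
  have dr: "drop j (adj u) = y # ys" using j by (simp add: y_def ys_def Cons_nth_drop_Suc)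
  have u: "u \<in> pverts G" and c: "c \<in> {1..q}" and good: "good k (stack s)" and q: "nats s 0 0 = q"
    using inv by (auto simp: nbr_inv_def u_def c_def k_def)
  have y: "y \<in> pverts G" using adj_verts[OF u] j by (auto simp: y_def)
  have len: "length (y # ys) \<le> \<Delta>" using drop_adj(2)[OF u, of j] by (simp add: dr)
  have ys: "set ys \<subseteq> pverts G" "length ys \<le> \<Delta>" unfolding ys_def by (rule drop_adj[OF u])+
  have R: "?R s' \<le> ennreal (nbr_val \<beta> x' \<kappa> s' ys 6)"
    if "nbr_inv F s'" "nats s' 9 0 = j" "nats s' 6 0 = u" for s'
    using ert_nbr_next[OF that(1), of x'] that by (simp add: ys_def)
  define T where "T = \<kappa> * (15 * real (length ys) + 100 * real \<Delta> * real n)"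
  have T: "0 \<le> T" using \<kappa> by (simp add: T_def)
  define V where "V = quad \<beta> x' w (mean md k (y # ys) c) (moment md k (y # ys) c n)"
  \<comment> \<open>Here 19 is 15 for the neighbor \<open>y\<close> plus the final 4.\<close>
  have goal: "nbr_val \<beta> x' \<kappa> s (drop (nats s 9 0) (adj (nats s 6 0))) 4 = V + T + \<kappa> * 19"
    unfolding u_def[symmetric] j_def[symmetric] dr
    by (simp add: nbr_val_def V_def T_def md_def k_def c_def n_def w_def algebra_simps)
  consider (same) "k y = c" | (other) "k y \<noteq> c" "k y \<noteq> 0" | (unc) "k y = 0" using c by auto
  then have "\<kappa> + ert adj \<kappa> nbr_body (nbr_pot \<beta> x' \<kappa> F) s \<le> ennreal (V + T + \<kappa> * 19)"
  proof cases
    case same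
    show ?thesis
    proof (cases "md = 0")
      case True
      let ?s = "rset 2 0 0 s"
      have inv': "nbr_inv F ?s" using inv by (simp add: nbr_inv_def frame_def stack_def)
      have "nbr_val \<beta> x' \<kappa> ?s ys 6 \<le> V + T + \<kappa> * 6"
        using quad_same_color(2)[OF \<beta>, of k y c x' "mean 0 k ys c" "moment 0 k ys c n" w ys n] same c True
        by (simp add: nbr_val_def V_def T_def c_def k_def n_def md_def algebra_simps)
      moreover have "0 \<le> nbr_val \<beta> x' \<kappa> ?s ys 6" by (rule nbr_val_nonneg[OF inv' ys]) simp
      ultimately have "((+) (ennreal \<kappa>) ^^ 5) (?R ?s) \<le> ennreal (V + T + \<kappa> * 19)"
        using \<kappa> by (intro add_costs_le[OF R[OF inv']]) (auto simp: j_def u_def)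
      then show ?thesis
        using same c True x10 by (simp add: nbr_body_def nbr_colored_def funpow_numerals k_def c_def md_def)
    next
      case False
      then have md1: "md = 1" using md by simp
      let ?s = "nset 8 0 2 s"
      have inv': "nbr_inv F ?s" using inv by (simp add: nbr_inv_def frame_def stack_def)
      have "nbr_val \<beta> x' \<kappa> ?s ys 6 \<le> V + T + \<kappa> * 6"
        using quad_same_color(1)[OF \<beta>, of k y c x' w ys n] same c md1
        by (simp add: nbr_val_def V_def T_def c_def k_def n_def w_def algebra_simps)
      moreover have "0 \<le> nbr_val \<beta> x' \<kappa> ?s ys 6" by (rule nbr_val_nonneg[OF inv' ys]) simp
      ultimately have "((+) (ennreal \<kappa>) ^^ 5) (?R ?s) \<le> ennreal (V + T + \<kappa> * 19)"
        using \<kappa> by (intro add_costs_le[OF R[OF inv']]) (auto simp: j_def u_def)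
      then show ?thesis
        using same c md1 x10 by (simp add: nbr_body_def nbr_colored_def funpow_numerals k_def c_def md_def)
    qed
  next
    case other
    have "nbr_val \<beta> x' \<kappa> s ys 6 \<le> V + T + \<kappa> * 6"
      using quad_other_color[of \<beta> k y c md x' w ys n, OF \<beta> other md]
      by (simp add: nbr_val_def V_def T_def c_def k_def n_def md_def w_def algebra_simps)
    moreover have "0 \<le> nbr_val \<beta> x' \<kappa> s ys 6" by (rule nbr_val_nonneg[OF inv ys]) simp
    ultimately have "((+) (ennreal \<kappa>) ^^ 4) (?R s) \<le> ennreal (V + T + \<kappa> * 19)"
      using \<kappa> by (intro add_costs_le[OF R[OF inv]]) (auto simp: j_def u_def)
    moreover have "k y < c \<or> c < k y" using other by auto
    ultimately show ?thesis
      using other x10 by (auto simp: nbr_body_def nbr_colored_def funpow_numerals k_def c_def)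
  next
    case unc
    define V1 where "V1 = quad \<beta> x' (w * q * (2 * real md - 1) / 2)
       (mean 0 (k(y := c)) ys c) (moment 0 (k(y := c)) ys c (Suc n))"
    define V2 where "V2 = quad \<beta> x' (w * q / (real q - 2)) (mean md k ys c) (moment md k ys c n)"
    \<comment> \<open>The summand \<open>100 * \<Delta>\<close> is the charge for the new stack
      entry; 12 is 6 from \<open>ert_nbr_next\<close> plus the branching and five commands.\<close>
    define v1 where "v1 = V1 + T + \<kappa> * (100 * real \<Delta> + 12)"
    define v2 where "v2 = V2 + T + \<kappa> * 8"
    let ?C = "Cond (NLess (var 11) (Const 2)) nbr_push nbr_skip"
    have 1: "ert adj \<kappa> ?C ?R (nset 11 0 r s) \<le> ennreal v1 \<and> 0 \<le> v1" if "r < 2" for r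
    proof -
      let ?s = "nset 8 0 0 (rset 2 0 (w * q * (real (md + md) - 1) / 2) (nset 5 0 (Suc n)
        (nset 4 n y (nset 3 y c (nset 11 0 r s)))))"
      have st: "stack ?s = y # stack s" by (rule stack_push) (simp_all add: n_def)
      have inv': "nbr_inv F ?s"
        using inv good_push[OF good unc y c] unfolding nbr_inv_def st
        by (simp add: frame_def k_def)
      have val: "nbr_val \<beta> x' \<kappa> ?s ys 6 = V1 + T + \<kappa> * (100 * real \<Delta> + 6)"
        by (simp add: nbr_val_def V1_def T_def c_def[symmetric] k_def[symmetric] algebra_simps)
      have nn: "0 \<le> nbr_val \<beta> x' \<kappa> ?s ys 6" by (rule nbr_val_nonneg[OF inv' ys]) simp
      have "nbr_val \<beta> x' \<kappa> ?s ys 6 + real 6 * \<kappa> \<le> v1"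
        unfolding val v1_def by (simp add: algebra_simps)
      then have "((+) (ennreal \<kappa>) ^^ 6) (?R ?s) \<le> ennreal v1"
        using \<kappa> nn by (intro add_costs_le[OF R[OF inv']]) (auto simp: j_def u_def)
      moreover have "0 \<le> v1" using nn[unfolded val] \<kappa> by (simp add: v1_def algebra_simps)
      ultimately show ?thesis
        using that x10 q
        by (simp add: nbr_push_def funpow_numerals c_def md_def n_def w_def)
    qed
    have 2: "ert adj \<kappa> ?C ?R (nset 11 0 r s) \<le> ennreal v2 \<and> 0 \<le> v2" if "\<not> r < 2" for r
    proof -
      let ?s = "rset 2 0 (w * q / (real q - 2)) (nset 11 0 r s)"
      have inv': "nbr_inv F ?s" using inv by (simp add: nbr_inv_def frame_def stack_def)
      have val: "nbr_val \<beta> x' \<kappa> ?s ys 6 = V2 + T + \<kappa> * 6"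
        by (simp add: nbr_val_def V2_def T_def c_def k_def n_def md_def algebra_simps)
      have nn: "0 \<le> nbr_val \<beta> x' \<kappa> ?s ys 6" by (rule nbr_val_nonneg[OF inv' ys]) simp
      have "((+) (ennreal \<kappa>) ^^ 2) (?R ?s) \<le> ennreal v2"
        using \<kappa> nn by (intro add_costs_le[OF R[OF inv']]) (auto simp: j_def u_def val v2_def algebra_simps)
      moreover have "0 \<le> v2" using nn \<kappa> by (simp add: val v2_def algebra_simps)
      ultimately show ?thesis
        using that q by (simp add: nbr_skip_def funpow_numerals w_def)
    qed
    have v12: "0 \<le> v1" "0 \<le> v2" using 1[of 0] 2[of 2] by simp_all
    define v where "v = (2 * v1 + (real q - 2) * v2) / q"
    have qq: "65 \<le> real q" "real \<Delta> / q \<le> 1 / 65" using q_ge q_pos by (auto simp: field_simps)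
    have "ert adj \<kappa> nbr_uncolored ?R s = ert adj \<kappa> (Rand 11 (Const 0) (NMinus num_colors (Const 1))) (ert adj \<kappa> ?C ?R) s"
      by (simp only: nbr_uncolored_def ert_Seq)
    also have "\<dots> \<le> \<kappa> + ennreal ((\<Sum>r\<le>nval (NMinus num_colors (Const 1)) s. if r < 2 then v1 else v2) /
            real (nval (NMinus num_colors (Const 1)) s + 1))"
      using 1 2 by (intro ert_Rand_le) auto
    also have "(\<Sum>r\<le>nval (NMinus num_colors (Const 1)) s. if r < 2 then v1 else v2) /
            real (nval (NMinus num_colors (Const 1)) s + 1) = v"
      using q_pos sum_if_less_2[of q v1 v2] by (simp add: q v_def of_nat_diff)
    finally have "\<kappa> + ert adj \<kappa> nbr_body (nbr_pot \<beta> x' \<kappa> F) s \<le> ((+) (ennreal \<kappa>) ^^ 3) (ennreal v)"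
      using x10 unc
      by (simp add: nbr_body_def k_def funpow_numerals add_left_mono)
    also have "\<dots> \<le> ennreal (V + T + \<kappa> * 19)"
    proof (rule add_costs_le[OF order_refl])
      show "0 \<le> v" using v12 qq by (simp add: v_def)
      have "v = (2 / q * V1 + (1 - 2 / q) * V2) + T + \<kappa> * (8 + 200 * (real \<Delta> / q) + 8 / q)"
        using qq by (simp add: v_def v1_def v2_def field_simps)
      also have "\<dots> \<le> V + T + \<kappa> * (8 + 200 / 65 + 8 / 65)"
      proof (intro add_mono order_refl mult_left_mono)
        show "2 / q * V1 + (1 - 2 / q) * V2 \<le> V"
          unfolding V1_def V2_def V_def using c \<beta> unc md len by (intro quad_uncolored) auto
        show "200 * (real \<Delta> / q) \<le> 200 / (65::real)" using qq(2) by linarith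
        show "8 / real q \<le> 8 / 65" using qq by (intro divide_left_mono) auto
      qed (fact \<kappa>)
      finally show "v + real 3 * \<kappa> \<le> V + T + \<kappa> * 19" using \<kappa> by (simp add: algebra_simps)
    qed (fact \<kappa>)
    finally show ?thesis .
  qed
  then show ?thesis unfolding goal .
qed

lemma ert_walk_end:
  assumes inv: "nbr_inv F s" and x: "nats s 10 0 = probe adj (nats s 6 0) (nats s 9 0)"
    and guard: "\<not> bval nbr_guard s"
  shows "\<kappa> + ert adj \<kappa> walk_end (walk_pot \<beta> x' \<kappa> F) s \<le>
    ennreal (nbr_val \<beta> x' \<kappa> s (drop (nats s 9 0) (adj (nats s 6 0))) 4)"
proof -
  define ys where "ys = drop (nats s 9 0) (adj (nats s 6 0))"
  define md where "md = nats s 8 0"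
  define n where "n = nats s 5 0"
  have good: "good (nats s 3) (stack s)" using inv by (simp add: nbr_inv_def)
  have nil: "ys = []" if "md \<noteq> 2"
    using that guard x inv
    by (auto simp: nbr_guard_def md_def ys_def nbr_inv_def probe_def split: if_splits)
  have sq: "(P (nats s 3))\<^sup>2 \<le> ((2 / q) ^ n)\<^sup>2" using P_square_le[OF good] by (simp add: n_def)
  show ?thesis
  proof (cases "md = 1")
    case True
    let ?s = "rset 2 0 0 s"
    have "walk_pot \<beta> x' \<kappa> F ?s = ennreal (\<beta> * x'\<^sup>2 + \<kappa> * (100 * real \<Delta> * real n + 1))"
      using inv by (simp add: walk_pot_def walk_inv_def nbr_inv_def frame_def stack_def walk_val_def
          quad_def n_def)
    moreover have "nbr_val \<beta> x' \<kappa> s ys 4 = \<beta> * x'\<^sup>2 + \<kappa> * (100 * real \<Delta> * real n + 4)"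
      using True nil by (simp add: nbr_val_def md_def[symmetric] quad_def mean_def moment_def hit_def n_def)
    moreover have "((+) (ennreal \<kappa>) ^^ 3) (ennreal (\<beta> * x'\<^sup>2 + \<kappa> * (100 * real \<Delta> * real n + 1)))
        \<le> ennreal (\<beta> * x'\<^sup>2 + \<kappa> * (100 * real \<Delta> * real n + 4))"
      using \<beta> \<kappa> by (intro add_costs_le[OF order_refl]) (auto simp: algebra_simps)
    ultimately show ?thesis
      using True unfolding ys_def[symmetric] by (simp add: walk_end_def md_def funpow_numerals)
  next
    case False
    define V where "V = quad \<beta> x' (reals s 2 0) (P (nats s 3)) (((2 / q) ^ n)\<^sup>2)"
    have V: "0 \<le> V" unfolding V_def by (intro quad_nonneg \<beta> sq)
    have "walk_pot \<beta> x' \<kappa> F s = ennreal (V + \<kappa> * (100 * real \<Delta> * real n + 1))"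
      using inv by (simp add: walk_pot_def walk_inv_def nbr_inv_def walk_val_def V_def n_def)
    moreover have "V + \<kappa> * (100 * real \<Delta> * real n + 4) \<le> nbr_val \<beta> x' \<kappa> s ys 4"
      using False nil \<kappa> by (cases "md = 2")
        (auto simp: nbr_val_def md_def[symmetric] mean_def moment_def n_def V_def intro!: mult_left_mono)
    moreover have "((+) (ennreal \<kappa>) ^^ 3) (ennreal (V + \<kappa> * (100 * real \<Delta> * real n + 1)))
        \<le> ennreal (V + \<kappa> * (100 * real \<Delta> * real n + 4))"
      using V \<kappa> by (intro add_costs_le[OF order_refl]) (auto simp: algebra_simps)
    ultimately show ?thesis
      using False unfolding ys_def[symmetric]
      by (auto simp: walk_end_def md_def funpow_numerals intro: order_trans ennreal_leI)
  qed
qed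

lemma ert_walk_nbrs:
  assumes "nbr_inv F s"
  shows "ert adj \<kappa> walk_nbrs (walk_pot \<beta> x \<kappa> F) s \<le> ennreal (nbr_val \<beta> x \<kappa> s (adj (nats s 6 0)) 6)"
proof -
  let ?ys = "adj (nats s 6 0)"
  let ?s = "nset 10 0 (probe adj (nats s 6 0) 0) (nset 9 0 0 s)"
  have loop: "ert adj \<kappa> (While nbr_guard nbr_body) (ert adj \<kappa> walk_end (walk_pot \<beta> x \<kappa> F)) s'
      \<le> nbr_pot \<beta> x \<kappa> F s'" for s'
    by (rule ert_While_le) (auto simp: nbr_pot_def ert_nbr_body ert_walk_end)
  have "stack ?s = stack s" "frame ?s = frame s" by (auto intro!: stack_cong simp: frame_def)
  then have "nbr_pot \<beta> x \<kappa> F ?s = ennreal (nbr_val \<beta> x \<kappa> s ?ys 4)"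
    using assms by (simp add: nbr_pot_def nbr_inv_def nbr_val_def)
  with loop[of ?s] have "ert adj \<kappa> walk_nbrs (walk_pot \<beta> x \<kappa> F) s
      \<le> ((+) (ennreal \<kappa>) ^^ 2) (ennreal (nbr_val \<beta> x \<kappa> s ?ys 4))"
    by (simp add: walk_nbrs_def funpow_numerals add_left_mono del: ert.simps(8))
  also have "\<dots> \<le> ennreal (nbr_val \<beta> x \<kappa> s ?ys 6)"
    using assms \<kappa> drop_adj[of "nats s 6 0" 0]
    by (intro add_costs_le[OF order_refl] nbr_val_nonneg[OF assms])
      (auto simp: nbr_inv_def nbr_val_def algebra_simps)
  finally show ?thesis .
qed

lemma ert_walk_body:
  assumes inv: "walk_inv F s" and guard: "bval walk_guard s"
  shows "\<kappa> + ert adj \<kappa> walk_body (walk_pot \<beta> x \<kappa> F) s \<le> ennreal (walk_val \<beta> x \<kappa> s)"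
proof -
  define n where "n = nats s 5 0 - 1"
  define u where "u = nats s 4 n"
  define k where "k = nats s 3"
  define w where "w = reals s 2 0"
  define st where "st = stack (nset 5 0 n s)"
  let ?R = "ert adj \<kappa> walk_nbrs (walk_pot \<beta> x \<kappa> F)"
  let ?N = "adj u"
  have n: "nats s 5 0 = Suc n" using guard by (simp add: walk_guard_def n_def)
  have stack: "stack s = u # st"
    unfolding st_def u_def using n by (subst stack_pop) (simp_all add: n_def)
  have len_st: "length st = n" by (simp add: st_def)
  have q: "nats s 0 0 = q" and good: "good k (u # st)"
    using inv by (auto simp: walk_inv_def k_def stack)
  have u: "u \<in> pverts G" "k u \<in> {1..q}" using good by (auto simp: good_def)
  have N: "set ?N \<subseteq> pverts G" "length ?N \<le> \<Delta>" using drop_adj[OF u(1), of 0] by simp_all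
  have qq: "65 \<le> real q" using q_pos by simp
  define e where "e = real (length ?N)"
  have e: "e \<le> \<Delta>" "0 \<le> e" using N by (simp_all add: e_def)
  define T where "T = \<kappa> * (15 * e + 100 * real \<Delta> * real n)"
  have T: "0 \<le> T" using \<kappa> e by (simp add: T_def)
  define V0 where "V0 = quad \<beta> x (w * 2 / q) (mean 0 (k(u := 0)) ?N (k u)) (moment 0 (k(u := 0)) ?N (k u) n)"
  define V1 where "V1 c = quad \<beta> x (w * 2) (mean 1 k ?N c) (moment 1 k ?N c (Suc n))" for c
  define v0 where "v0 = V0 + T + \<kappa> * 12"
  define v1 where "v1 c = V1 c + T + \<kappa> * (100 * real \<Delta> + 9)" for c
  define v2 where "v2 = \<kappa> * 2 + (\<Sum>c\<in>{1..q}. v1 c) / q"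
  let ?s = "nset 6 0 u s"
  have pop: "ert adj \<kappa> (Cond (NLess (var 11) (Const 1)) walk_pop walk_keep) ?R (nset 11 0 0 ?s) \<le> ennreal v0 \<and> 0 \<le> v0"
  proof -
    let ?s' = "nset 8 0 0 (rset 2 0 (w * 2 / q) (nset 5 0 n (nset 3 u 0 (nset 7 0 (k u) (nset 11 0 0 ?s)))))"
    have st': "stack ?s' = st" by (simp add: stack_def st_def)
    have inv': "nbr_inv F ?s'"
      using inv good_pop[OF good] u unfolding nbr_inv_def walk_inv_def st'
      by (simp add: frame_def k_def)
    have val: "nbr_val \<beta> x \<kappa> ?s' ?N 6 = V0 + T + \<kappa> * 6"
      by (simp add: nbr_val_def V0_def T_def e_def k_def[symmetric] algebra_simps)
    have nn: "0 \<le> nbr_val \<beta> x \<kappa> ?s' ?N 6" by (rule nbr_val_nonneg[OF inv' N]) simp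
    have R: "?R ?s' \<le> ennreal (nbr_val \<beta> x \<kappa> ?s' ?N 6)" using ert_walk_nbrs[OF inv'] by simp
    have "((+) (ennreal \<kappa>) ^^ 6) (?R ?s') \<le> ennreal v0"
      using \<kappa> nn by (intro add_costs_le[OF R]) (auto simp: val v0_def algebra_simps)
    moreover have "0 \<le> v0" using nn \<kappa> by (simp add: val v0_def algebra_simps)
    ultimately show ?thesis
      using q n by (simp add: walk_pop_def funpow_numerals k_def w_def)
  qed
  let ?K = walk_recolor
  have keep1: "ert adj \<kappa> ?K ?R (nset 7 0 r (nset 11 0 1 ?s)) \<le> ennreal (v1 (Suc r)) \<and> 0 \<le> v1 (Suc r)"
    if "r \<le> q - 1" for r
  proof -
    let ?s' = "nset 8 0 (Suc 0) (rset 2 0 (w * 2) (nset 7 0 (Suc r) (nset 7 0 r (nset 11 0 (Suc 0) ?s))))"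
    have st': "stack ?s' = u # st" unfolding stack[symmetric] by (simp add: stack_def)
    have inv': "nbr_inv F ?s'"
      using inv good u that q_pos unfolding nbr_inv_def walk_inv_def st'
      by (simp add: frame_def k_def)
    have val: "nbr_val \<beta> x \<kappa> ?s' ?N 6 = V1 (Suc r) + T + \<kappa> * (100 * real \<Delta> + 6)"
      by (simp add: nbr_val_def V1_def T_def e_def k_def[symmetric] n algebra_simps)
    have nn: "0 \<le> nbr_val \<beta> x \<kappa> ?s' ?N 6" by (rule nbr_val_nonneg[OF inv' N]) simp
    have R: "?R ?s' \<le> ennreal (nbr_val \<beta> x \<kappa> ?s' ?N 6)" using ert_walk_nbrs[OF inv'] by simp
    have "((+) (ennreal \<kappa>) ^^ 3) (?R ?s') \<le> ennreal (v1 (Suc r))"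
      using \<kappa> nn by (intro add_costs_le[OF R]) (auto simp: val v1_def algebra_simps)
    moreover have "0 \<le> v1 (Suc r)" using nn \<kappa> by (simp add: val v1_def algebra_simps)
    ultimately show ?thesis by (simp add: walk_recolor_def funpow_numerals w_def)
  qed
  have sum_shift: "(\<Sum>r\<le>q - 1. f (Suc r)) = (\<Sum>c\<in>{1..q}. f c)" for f :: "nat \<Rightarrow> real"
    using q_pos by (intro sum.reindex_bij_witness[of _ "\<lambda>c. c - 1" Suc]) auto
  have keep: "ert adj \<kappa> (Cond (NLess (var 11) (Const 1)) walk_pop walk_keep) ?R (nset 11 0 1 ?s) \<le> ennreal v2 \<and> 0 \<le> v2"
  proof -
    let ?a = "NMinus num_colors (Const 1)" and ?s1 = "nset 11 0 1 ?s"
    have nn: "0 \<le> (\<Sum>c\<in>{1..q}. v1 c) / q"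
      unfolding sum_shift[symmetric] using keep1 by (intro divide_nonneg_nonneg sum_nonneg) auto
    have "ert adj \<kappa> (Rand 7 (Const 0) ?a) (ert adj \<kappa> ?K ?R) ?s1
        \<le> \<kappa> + ennreal ((\<Sum>r\<le>nval ?a ?s1. v1 (Suc r)) / real (nval ?a ?s1 + 1))"
      using keep1 q by (intro ert_Rand_le) auto
    also have "(\<Sum>r\<le>nval ?a ?s1. v1 (Suc r)) / real (nval ?a ?s1 + 1) = (\<Sum>c\<in>{1..q}. v1 c) / q"
      unfolding sum_shift[symmetric] using q q_pos by (simp add: of_nat_diff)
    finally have "ert adj \<kappa> (Cond (NLess (var 11) (Const 1)) walk_pop walk_keep) ?R ?s1
        \<le> ((+) (ennreal \<kappa>) ^^ 2) (ennreal ((\<Sum>c\<in>{1..q}. v1 c) / q))"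
      by (simp add: walk_keep_def funpow_numerals add_left_mono del: ert.simps(5))
    also have "\<dots> \<le> ennreal v2"
      using nn \<kappa> by (intro add_costs_le[OF order_refl]) (auto simp: v2_def)
    finally show ?thesis using nn \<kappa> by (simp add: v2_def)
  qed
  let ?C = "Cond (NLess (var 11) (Const 1)) walk_pop walk_keep"
  let ?g = "\<lambda>r. if r = (0::nat) then v0 else v2"
  have "ert adj \<kappa> (Rand 11 (Const 0) (Const 1)) (ert adj \<kappa> ?C ?R) ?s
      \<le> \<kappa> + ennreal ((\<Sum>r\<le>nval (Const 1) ?s. ?g r) / real (nval (Const 1) ?s + 1))"
    using pop keep by (intro ert_Rand_le) (auto simp: le_Suc_eq simp del: ert.simps(7))
  also have "(\<Sum>r\<le>nval (Const 1) ?s. ?g r) / real (nval (Const 1) ?s + 1) = (v0 + v2) / 2"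
    by simp
  finally have "\<kappa> + ert adj \<kappa> walk_body (walk_pot \<beta> x \<kappa> F) s \<le> ((+) (ennreal \<kappa>) ^^ 3) (ennreal ((v0 + v2) / 2))"
    by (simp add: walk_body_def funpow_numerals add_left_mono n u_def ert_Seq del: ert.simps(5,7))
  also have "\<dots> \<le> ennreal (walk_val \<beta> x \<kappa> s)"
  proof (rule add_costs_le[OF order_refl])
    show "0 \<le> (v0 + v2) / 2" using pop keep by simp
    have "(\<Sum>c\<in>{1..q}. v1 c) / q = (\<Sum>c\<in>{1..q}. V1 c) / q + T + \<kappa> * (100 * real \<Delta> + 9)"
      using qq by (simp add: v1_def sum.distrib add_divide_distrib)
    then have "(v0 + v2) / 2 = (1 / 2 * V0 + 1 / 2 * ((\<Sum>c\<in>{1..q}. V1 c) / q)) + T + \<kappa> * (50 * real \<Delta> + 23 / 2)"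
      by (simp add: v0_def v2_def algebra_simps)
    also have "\<dots> \<le> quad \<beta> x w (P k) (((2 / q) ^ Suc n)\<^sup>2) + T + \<kappa> * (50 * real \<Delta> + 23 / 2)"
      using quad_walk[OF \<beta> good, of x w] by (simp add: V0_def V1_def len_st)
    also have "T \<le> \<kappa> * (15 * real \<Delta> + 100 * real \<Delta> * real n)"
      unfolding T_def using e \<kappa> by (intro mult_left_mono) auto
    finally have "(v0 + v2) / 2 + real 3 * \<kappa>
       \<le> quad \<beta> x w (P k) (((2 / q) ^ Suc n)\<^sup>2) + \<kappa> * (65 * real \<Delta> + 100 * real \<Delta> * real n + 29 / 2)"
      by (simp add: algebra_simps add_divide_distrib)
    \<comment> \<open>The constant is absorbed by the remaining \<open>35 * \<Delta>\<close>, as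
      \<Delta> \<ge> 1.\<close>
    also have "\<dots> \<le> quad \<beta> x w (P k) (((2 / q) ^ Suc n)\<^sup>2) + \<kappa> * (100 * real \<Delta> * real (Suc n) + 1)"
      using \<kappa> \<Delta>_pos by (intro add_left_mono mult_left_mono) (auto simp: algebra_simps)
    finally show "(v0 + v2) / 2 + real 3 * \<kappa> \<le> walk_val \<beta> x \<kappa> s"
      by (simp only: walk_val_def n w_def k_def)
  qed (fact \<kappa>)
  finally show ?thesis .
qed

text \<open>With an empty stack \<open>k = k\<^sub>0\<close>, so mean and second moment of the
  remaining factor are 1 and \<open>quad\<close> collapses to the square of
  \<open>x + w\<close>.\<close>

lemma ert_walk:
  fixes f :: "state \<Rightarrow> ennreal"
  assumes "\<And>s. walk_inv F s \<Longrightarrow> nats s 5 0 = 0 \<Longrightarrow> \<kappa> + f s \<le> ennreal (\<beta> * (x + reals s 2 0)\<^sup>2 + \<kappa>)"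
  shows "ert adj \<kappa> (While walk_guard walk_body) f s \<le> walk_pot \<beta> x \<kappa> F s"
proof (rule ert_While_le)
  fix s
  have "\<kappa> + f s \<le> ennreal (walk_val \<beta> x \<kappa> s)" if "walk_inv F s" "\<not> bval walk_guard s"
  proof -
    have n: "nats s 5 0 = 0" using that by (simp add: walk_guard_def)
    then have "nats s 3 = k\<^sub>0" using that by (simp add: walk_inv_def good_Nil stack_def)
    then have "walk_val \<beta> x \<kappa> s = \<beta> * (x + reals s 2 0)\<^sup>2 + \<kappa>"
      using n by (simp add: walk_val_def quad_def power2_sum algebra_simps)
    then show ?thesis using assms[OF that(1) n] by simp
  qed
  then show "\<kappa> + (if bval walk_guard s then ert adj \<kappa> walk_body (walk_pot \<beta> x \<kappa> F) s else f s) \<le> walk_pot \<beta> x \<kappa> F s"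
    using ert_walk_body[of F s x] by (auto simp: walk_pot_def)
qed

end

end

section \<open>Averaging\<close>

text \<open>Carries the costs and error terms of everything after a walk through it, although the
  potential of the walk has a fixed shape.\<close>

lemma ert_add_const: "ert adj k p (\<lambda>s. f s + c) s \<le> ert adj k p f s + c"
proof (induction p arbitrary: f s)
  case (Rand x i a)
  have "(\<integral>\<^sup>+ r. f (nset x (nval i s) r s) + c \<partial>measure_spmf (spmf_of_set {0..nval a s}))
      = (\<integral>\<^sup>+ r. f (nset x (nval i s) r s) \<partial>measure_spmf (spmf_of_set {0..nval a s}))
        + (\<integral>\<^sup>+ r. c \<partial>measure_spmf (spmf_of_set {0..nval a s}))"
    by (rule nn_integral_add) simp_all
  also have "\<dots> \<le> (\<integral>\<^sup>+ r. f (nset x (nval i s) r s) \<partial>measure_spmf (spmf_of_set {0..nval a s})) + c"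
    by (intro add_left_mono nn_integral_const_measure_spmf_le)
  finally show ?case by (simp add: add.assoc add_left_mono)
next
  case (Seq p1 p2)
  have "ert adj k p1 (ert adj k p2 (\<lambda>s. f s + c)) s \<le> ert adj k p1 (\<lambda>s. ert adj k p2 f s + c) s"
    using ert_mono[of "ert adj k p2 (\<lambda>s. f s + c)" "\<lambda>s. ert adj k p2 f s + c" adj k p1] Seq.IH(2)
    by (simp add: le_fun_def)
  also have "\<dots> \<le> ert adj k p1 (ert adj k p2 f) s + c" by (rule Seq.IH(1))
  finally show ?case by simp
next
  case (Cond b p1 p2)
  then show ?case by (auto simp: add.assoc intro!: add_left_mono)
next
  case (While b p)
  show ?case
  proof (rule ert_While_le)
    fix s :: state
    have "k + (if bval b s then ert adj k p (\<lambda>s. ert adj k (While b p) f s + c) s else f s + c)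
        \<le> k + (if bval b s then ert adj k p (ert adj k (While b p) f) s else f s) + c"
      using While.IH by (auto simp: add.assoc intro!: add_left_mono simp del: ert.simps)
    also have "\<dots> = ert adj k (While b p) f s + c"
      using ert_While_unfold[of adj k b p f s] by (simp del: ert.simps)
    finally show "k + (if bval b s then ert adj k p (\<lambda>s. ert adj k (While b p) f s + c) s else f s + c)
        \<le> ert adj k (While b p) f s + c" .
  qed
qed (simp_all add: add.assoc)

abbreviation the_vertex :: nexp where "the_vertex \<equiv> NGet 0 (Const 1)"
abbreviation rel_error :: rexp where "rel_error \<equiv> RGet 0 (Const 0)"
abbreviation failure :: rexp where "failure \<equiv> RGet 0 (Const 1)"

definition sample :: com where
  "sample =
     NSet 3 the_vertex (var 12) ;;
     NSet 4 (Const 0) the_vertex ;;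
     NSet 5 (Const 0) (Const 1) ;;
     RSet 2 (Const 0) (OfNat (Const 1)) ;;
     While walk_guard walk_body ;;
     RSet 3 (Const 0) (RPlus (rvar 3) (rvar 2)) ;;
     NSet 13 (Const 0) (NPlus (var 13) (Const 1))"

text \<open>The machine cannot round, so the number of samples is never computed; the counter is
  compared with \<open>5 * q / (\<epsilon>\<^sup>2 * \<delta>)\<close> after multiplying
  out.\<close>

definition sample_guard :: bexp where
  "sample_guard = RLess (RTimes (OfNat (var 13)) (RTimes (RTimes rel_error rel_error) failure))
     (RTimes (OfNat (Const 5)) (OfNat num_colors))"

definition color_mean :: com where
  "color_mean =
     RSet 3 (Const 0) (OfNat (Const 0)) ;;
     NSet 13 (Const 0) (Const 0) ;;
     While sample_guard sample ;;
     RSet 1 (var 12) (RDivide (rvar 3) (OfNat (var 13)))"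

definition color_guard :: bexp where
  "color_guard = NLess (var 12) (NPlus num_colors (Const 1))"

text \<open>A skipped color keeps the initial output 0, which is its exact marginal.\<close>

definition color_body :: com where
  "color_body =
     Cond (NLess (Const 0) (NGet 14 (var 12))) Skip color_mean ;;
     NSet 12 (Const 0) (NPlus (var 12) (Const 1))"

definition load_guard :: bexp where
  "load_guard = NLess (var 15) (NGet 0 (Const 2))"

definition load_body :: com where
  "load_body =
     NSet 3 (NGet 1 (var 15)) (NGet 2 (var 15)) ;;
     NSet 15 (Const 0) (NPlus (var 15) (Const 1))"

definition mark_guard :: bexp where
  "mark_guard = NLess (Const 0) (var 10)"

definition mark_body :: com where
  "mark_body =
     NSet 14 (NGet 3 neighbor) (Const 1) ;;
     NSet 9 (Const 0) (NPlus (var 9) (Const 1)) ;;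
     Probe 10 (Const 0) the_vertex (var 9)"

definition estimator :: com where
  "estimator =
     While load_guard load_body ;;
     Probe 10 (Const 0) the_vertex (Const 0) ;;
     While mark_guard mark_body ;;
     NSet 12 (Const 0) (Const 1) ;;
     While color_guard color_body"

locale sampling_instance = coloring_instance +
  fixes vs :: "nat list" and \<epsilon> \<delta> \<kappa> :: real
  assumes vs: "set vs = \<Lambda>" and \<epsilon>: "0 < \<epsilon>" "\<epsilon> < 1" and \<delta>: "0 < \<delta>" "\<delta> < 1" and \<kappa>: "0 \<le> \<kappa>"
begin

lemma ert_walk_add:
  fixes f :: "state \<Rightarrow> ennreal"
  assumes \<beta>: "0 \<le> \<beta>" and C: "0 \<le> C"
    and f: "\<And>s. walk_inv F s \<Longrightarrow> nats s 3 = k\<^sub>0 \<Longrightarrow> f s \<le> ennreal (\<beta> * (x + reals s 2 0)\<^sup>2 + C)"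
  shows "ert adj \<kappa> (While walk_guard walk_body) f s \<le> walk_pot \<beta> x \<kappa> F s + ennreal C"
proof -
  define g where "g s = (if walk_inv F s \<and> nats s 5 0 = 0 then ennreal (\<beta> * (x + reals s 2 0)\<^sup>2) else \<top>)" for s
  let ?W = "While walk_guard walk_body"
  have "f s \<le> g s + ennreal C" for s
  proof (cases "walk_inv F s \<and> nats s 5 0 = 0")
    case True
    then have "stack s = []" by (simp add: stack_def)
    then have "nats s 3 = k\<^sub>0" using True by (simp add: walk_inv_def good_Nil)
    then show ?thesis using f[of s] True \<beta> C by (simp add: g_def)
  next
    case False
    then have "g s = \<top>" unfolding g_def by (rule if_not_P)
    then show ?thesis by simp
  qed
  then have "ert adj \<kappa> ?W f s \<le> ert adj \<kappa> ?W (\<lambda>s. g s + ennreal C) s"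
    using ert_mono[of f "\<lambda>s. g s + ennreal C"] by (simp add: le_fun_def del: ert.simps)
  also have "\<dots> \<le> ert adj \<kappa> ?W g s + ennreal C" by (rule ert_add_const)
  also have "\<dots> \<le> walk_pot \<beta> x \<kappa> F s + ennreal C"
    using \<beta> \<kappa> by (intro add_right_mono ert_walk) (auto simp: g_def add.commute simp flip: ennreal_plus)
  finally show ?thesis .
qed

section \<open>Number of samples and deviation of their sum\<close>

definition M :: nat where "M = nat \<lceil>5 * q / (\<epsilon>\<^sup>2 * \<delta>)\<rceil>"

lemma less_M_iff: "m < M \<longleftrightarrow> real m * (\<epsilon> * \<epsilon> * \<delta>) < 5 * real q"
proof -
  have "m < M \<longleftrightarrow> real m < 5 * real q / (\<epsilon>\<^sup>2 * \<delta>)"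
    unfolding M_def by (simp add: less_ceiling_iff zless_nat_eq_int_zless)
  also have "\<dots> \<longleftrightarrow> real m * (\<epsilon> * \<epsilon> * \<delta>) < 5 * real q"
    using \<epsilon> \<delta> by (simp add: pos_less_divide_eq power2_eq_square)
  finally show ?thesis .
qed

lemma M_ge: "5 * real q \<le> real M * (\<epsilon>\<^sup>2 * \<delta>)"
  using less_M_iff[of M] by (simp add: power2_eq_square)

lemma M_pos: "0 < M"
  using q_pos by (simp add: less_M_iff)

lemma \<epsilon>\<delta>: "0 < \<epsilon>\<^sup>2 * \<delta>" "\<epsilon>\<^sup>2 * \<delta> \<le> 1"
  using \<epsilon> \<delta> by (auto intro!: mult_le_one power_le_one)

lemma M_le: "real M \<le> 6 * q / (\<epsilon>\<^sup>2 * \<delta>)"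
proof -
  have "real M \<le> 5 * q / (\<epsilon>\<^sup>2 * \<delta>) + 1"
    unfolding M_def using \<epsilon>\<delta> by (simp add: of_nat_nat)
  also have "1 \<le> real q / (\<epsilon>\<^sup>2 * \<delta>)" using \<epsilon>\<delta> q_pos by (simp add: pos_le_divide_eq)
  finally show ?thesis by (simp add: add_divide_distrib[symmetric])
qed

definition sample_inv :: "nat \<Rightarrow> (nat \<Rightarrow> nat) \<Rightarrow> (nat \<Rightarrow> real) \<Rightarrow> state \<Rightarrow> bool" where
  "sample_inv c bl es s \<longleftrightarrow> nats s 0 = load [q, v, length vs] \<and> nats s 3 = k\<^sub>0 \<and> nats s 12 0 = c \<and>
     nats s 13 0 \<le> M \<and> nats s 14 = bl \<and> reals s 0 = load [\<epsilon>, \<delta>] \<and> reals s 1 = es"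

text \<open>The deviation of the sum of the first \<open>m\<close> samples from its mean has second moment at most
  \<open>m\<close> times that of one sample.\<close>

definition sample_val :: "real \<Rightarrow> nat \<Rightarrow> real \<Rightarrow> state \<Rightarrow> real" where
  "sample_val \<gamma> c C s =
     \<gamma> * ((reals s 3 0 - nats s 13 0 * P (k\<^sub>0(v := c)))\<^sup>2 + (real M - nats s 13 0) * (2 / q)\<^sup>2) +
     \<kappa> * ((100 * real \<Delta> + 8) * (real M - nats s 13 0)) + C"

definition sample_pot where
  "sample_pot \<gamma> c bl es C s = (if sample_inv c bl es s then ennreal (sample_val \<gamma> c C s) else \<top>)"

text \<open>One sample costs \<open>100 * \<Delta> + 1\<close> for a walk from height 1, five units
  before it and two after it, which is the rate \<open>100 * \<Delta> + 8\<close> in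
  \<open>sample_val\<close>.\<close>

lemma ert_sample:
  assumes \<gamma>: "0 \<le> \<gamma>" and C: "0 \<le> C" and c: "c \<in> {1..q}"
    and inv: "sample_inv c bl es s" and m: "nats s 13 0 < M"
  shows "\<kappa> + ert adj \<kappa> sample (sample_pot \<gamma> c bl es C) s \<le> ennreal (sample_val \<gamma> c C s)"
proof -
  define m where "m = nats s 13 0"
  define a where "a = reals s 3 0"
  define p where "p = P (k\<^sub>0(v := c))"
  \<comment> \<open>Chosen so that \<open>x + w\<close> is the deviation of the sum once a sample
    \<open>w\<close> has been added.\<close>
  define x where "x = a - (real m + 1) * p"
  define C' where "C' = \<gamma> * ((real M - (real m + 1)) * (2 / q)\<^sup>2) +
    \<kappa> * ((100 * real \<Delta> + 8) * (real M - (real m + 1)) + 2) + C"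
  have mM: "real m + 1 \<le> real M" using m by (simp add: m_def)
  have C': "0 \<le> C'" using \<gamma> \<kappa> C mM by (simp add: C'_def)
  let ?s = "rset 2 0 1 (nset 5 0 (Suc 0) (nset 4 0 v (nset 3 v c s)))"
  have good: "good (k\<^sub>0(v := c)) [v]"
    using v c by (intro good_push) (auto simp: good_Nil k\<^sub>0_def)
  have inv1: "walk_inv (frame s) ?s"
    using inv good by (simp add: walk_inv_def frame_def stack_def sample_inv_def load_def)
  let ?f = "ert adj \<kappa> (RSet 3 (Const 0) (RPlus (rvar 3) (rvar 2)) ;;
     NSet 13 (Const 0) (NPlus (var 13) (Const 1))) (sample_pot \<gamma> c bl es C)"
  have "?f s' \<le> ennreal (\<gamma> * (x + reals s' 2 0)\<^sup>2 + C')" if "walk_inv (frame s) s'" "nats s' 3 = k\<^sub>0" for s'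
  proof -
    let ?s' = "nset 13 0 (Suc m) (rset 3 0 (a + reals s' 2 0) s')"
    have fr: "nats s' 0 = nats s 0" "nats s' 12 = nats s 12" "nats s' 13 = nats s 13"
        "nats s' 14 = nats s 14" "reals s' 0 = reals s 0" "reals s' 1 = reals s 1" "reals s' 3 = reals s 3"
      using that by (auto simp: walk_inv_def frame_def)
    have "sample_inv c bl es ?s'" using inv that m fr by (simp add: sample_inv_def m_def)
    moreover have val: "sample_val \<gamma> c C ?s' = \<gamma> * (x + reals s' 2 0)\<^sup>2 + (C' - 2 * \<kappa>)"
      by (simp add: sample_val_def x_def C'_def p_def algebra_simps)
    ultimately have "?f s' = ((+) (ennreal \<kappa>) ^^ 2) (ennreal (\<gamma> * (x + reals s' 2 0)\<^sup>2 + (C' - 2 * \<kappa>)))"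
      by (simp add: funpow_numerals sample_pot_def fr a_def m_def)
    also have "\<dots> \<le> ennreal (\<gamma> * (x + reals s' 2 0)\<^sup>2 + C')"
    proof (rule add_costs_le[OF order_refl])
      have "C' - 2 * \<kappa> = \<gamma> * ((real M - (real m + 1)) * (2 / q)\<^sup>2) +
          \<kappa> * ((100 * real \<Delta> + 8) * (real M - (real m + 1))) + C"
        by (simp add: C'_def algebra_simps)
      then have "0 \<le> C' - 2 * \<kappa>" using \<gamma> \<kappa> C mM by simp
      then show "0 \<le> \<gamma> * (x + reals s' 2 0)\<^sup>2 + (C' - 2 * \<kappa>)" using \<gamma> by simp
    qed (simp_all add: \<kappa>)
    finally show ?thesis .
  qed
  from ert_walk_add[where F = "frame s" and f = ?f and x = x, OF \<gamma> C' this, of ?s]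
  have "ert adj \<kappa> (While walk_guard walk_body) ?f ?s \<le> ennreal (walk_val \<gamma> x \<kappa> ?s) + ennreal C'"
    using inv1 by (simp add: walk_pot_def del: ert.simps)
  also have "walk_val \<gamma> x \<kappa> ?s = quad \<gamma> x 1 p ((2 / q)\<^sup>2) + \<kappa> * (100 * real \<Delta> + 1)"
    using inv by (simp add: walk_val_def sample_inv_def p_def)
  also have "ennreal \<dots> + ennreal C' = ennreal (quad \<gamma> x 1 p ((2 / q)\<^sup>2) + \<kappa> * (100 * real \<Delta> + 1) + C')"
    using \<gamma> \<kappa> C' P_square_le[OF good]
    by (intro ennreal_plus[symmetric] add_nonneg_nonneg quad_nonneg) (auto simp: p_def)
  finally have W: "ert adj \<kappa> (While walk_guard walk_body) ?f ?s \<le>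
    ennreal (quad \<gamma> x 1 p ((2 / q)\<^sup>2) + \<kappa> * (100 * real \<Delta> + 1) + C')" .
  have start: "nats s 0 (Suc 0) = v" "nats s 12 0 = c" using inv by (simp_all add: sample_inv_def load_def)
  have "\<kappa> + ert adj \<kappa> sample (sample_pot \<gamma> c bl es C) s =
      ((+) (ennreal \<kappa>) ^^ 5) (ert adj \<kappa> (While walk_guard walk_body) ?f ?s)"
    by (simp add: sample_def funpow_numerals start ert_Seq del: ert.simps(8))
  also have "\<dots> \<le> ennreal (sample_val \<gamma> c C s)"
  proof (rule add_costs_le[OF W])
    have "0 \<le> quad \<gamma> x 1 p ((2 / q)\<^sup>2)"
      using \<gamma> P_square_le[OF good] by (intro quad_nonneg) (auto simp: p_def)
    then show "0 \<le> quad \<gamma> x 1 p ((2 / q)\<^sup>2) + \<kappa> * (100 * real \<Delta> + 1) + C'"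
      using \<kappa> C' by simp
    \<comment> \<open>Since the sample has mean \<open>p\<close>, the cross term with the old
      deviation cancels. This martingale property takes the place of independence.\<close>
    have "quad \<gamma> x 1 p ((2 / q)\<^sup>2) = \<gamma> * ((a - m * p)\<^sup>2 - p\<^sup>2 + (2 / q)\<^sup>2)"
      by (simp add: quad_def x_def power2_eq_square algebra_simps)
    also have "\<dots> \<le> \<gamma> * ((a - m * p)\<^sup>2 + (2 / q)\<^sup>2)"
      using \<gamma> by (intro mult_left_mono) auto
    finally show "quad \<gamma> x 1 p ((2 / q)\<^sup>2) + \<kappa> * (100 * real \<Delta> + 1) + C' + real 5 * \<kappa> \<le> sample_val \<gamma> c C s"
      by (simp add: sample_val_def C'_def a_def[symmetric] m_def[symmetric] p_def[symmetric] algebra_simps)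
  qed (fact \<kappa>)
  finally show ?thesis .
qed

lemma ert_sample_loop:
  fixes f :: "state \<Rightarrow> ennreal"
  assumes \<gamma>: "0 \<le> \<gamma>" and C: "0 \<le> C" and c: "c \<in> {1..q}"
    and f: "\<And>s. sample_inv c bl es s \<Longrightarrow> nats s 13 0 = M \<Longrightarrow>
      \<kappa> + f s \<le> ennreal (\<gamma> * (reals s 3 0 - M * P (k\<^sub>0(v := c)))\<^sup>2 + C)"
  shows "ert adj \<kappa> (While sample_guard sample) f s \<le> sample_pot \<gamma> c bl es C s"
proof (rule ert_While_le)
  fix s :: state
  have "bval sample_guard s \<longleftrightarrow> nats s 13 0 < M" if "sample_inv c bl es s"
    using that by (simp add: sample_inv_def sample_guard_def load_def less_M_iff)
  moreover have "\<kappa> + f s \<le> ennreal (sample_val \<gamma> c C s)" if "sample_inv c bl es s" "\<not> nats s 13 0 < M"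
  proof -
    have "nats s 13 0 = M" using that by (simp add: sample_inv_def)
    then show ?thesis using f[OF that(1)] by (simp add: sample_val_def)
  qed
  ultimately show "\<kappa> + (if bval sample_guard s then ert adj \<kappa> sample (sample_pot \<gamma> c bl es C) s else f s)
      \<le> sample_pot \<gamma> c bl es C s"
    using ert_sample[OF \<gamma> C c] by (auto simp: sample_pot_def)
qed

section \<open>All colors\<close>

definition bad :: "state \<Rightarrow> nat \<Rightarrow> bool" where
  "bad s c \<longleftrightarrow> \<not> ((1 - \<epsilon>) * marginal G q \<Lambda> \<sigma> v c \<le> estimate s c \<and>
     estimate s c \<le> (1 + \<epsilon>) * marginal G q \<Lambda> \<sigma> v c)"

definition color_inv :: "state \<Rightarrow> bool" where
  "color_inv s \<longleftrightarrow> nats s 0 = load [q, v, length vs] \<and> nats s 3 = k\<^sub>0 \<and> nats s 12 0 \<in> {1..q + 1} \<and>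
     (\<forall>c\<in>{1..q}. 0 < nats s 14 c \<longleftrightarrow> blocked c) \<and> reals s 0 = load [\<epsilon>, \<delta>] \<and>
     (\<forall>c\<ge>nats s 12 0. reals s 1 c = 0)"

definition color_cost :: real where
  "color_cost = 800 * real \<Delta> * real q / (\<epsilon>\<^sup>2 * \<delta>)"

text \<open>The union bound as a potential: every color still to be treated holds
  \<open>\<delta> / q\<close> of failure probability.\<close>

definition color_val :: "state \<Rightarrow> real" where
  "color_val s = of_bool (\<exists>c\<in>{1..<nats s 12 0}. bad s c) + (real q + 1 - nats s 12 0) * (\<delta> / q) +
     \<kappa> * (color_cost * (real q + 1 - nats s 12 0) + 1)"

definition color_pot where
  "color_pot s = (if color_inv s then ennreal (color_val s) else \<top>)"

definition failed :: "state \<Rightarrow> ennreal" where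
  "failed s = ennreal (of_bool (\<exists>c\<in>{1..q}. bad s c))"

text \<open>From \<open>100 * \<Delta> + 8 \<le> 108 * \<Delta>\<close> and \<open>M_le\<close> the
  samples cost 108 * 6 = 648 of the 800 units; the rest covers the overhead of at most 8 per
  color.\<close>

lemma color_cost_ge: "(100 * real \<Delta> + 8) * real M + 8 \<le> color_cost"
proof -
  define y where "y = real \<Delta> * (real q / (\<epsilon>\<^sup>2 * \<delta>))"
  have D: "1 \<le> real \<Delta>" using \<Delta>_pos by simp
  have "real q / 1 \<le> real q / (\<epsilon>\<^sup>2 * \<delta>)" using \<epsilon>\<delta> by (intro divide_left_mono) auto
  then have z: "65 \<le> real q / (\<epsilon>\<^sup>2 * \<delta>)" using q_pos by simp
  have "(100 * real \<Delta> + 8) * real M \<le> (108 * real \<Delta>) * (6 * (real q / (\<epsilon>\<^sup>2 * \<delta>)))"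
    using D M_le by (intro mult_mono) auto
  also have "\<dots> = 648 * y" by (simp add: y_def)
  finally have "(100 * real \<Delta> + 8) * real M \<le> 648 * y" .
  moreover have "1 * 65 \<le> y" unfolding y_def using D z by (intro mult_mono) auto
  moreover have "color_cost = 800 * y" by (simp add: color_cost_def y_def)
  ultimately show ?thesis by linarith
qed

lemma color_cost_nonneg: "0 \<le> color_cost"
  using \<epsilon>\<delta> by (simp add: color_cost_def)

lemma color_val_nonneg: "color_inv s \<Longrightarrow> 0 \<le> color_val s"
  unfolding color_val_def color_inv_def using \<delta> \<kappa> color_cost_nonneg
  by (intro add_nonneg_nonneg mult_nonneg_nonneg) auto

text \<open>The pointwise inequality behind Chebyshev's: the indicator of failure is at most a
  multiple of the squared deviation. This multiple becomes the \<open>\<gamma>\<close> of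
  \<open>sample_val\<close>.\<close>

lemma bad_chebyshev:
  fixes a p :: real
  assumes "0 < p" "\<not> ((1 - \<epsilon>) * p \<le> a / M \<and> a / M \<le> (1 + \<epsilon>) * p)"
  shows "1 \<le> 1 / (\<epsilon> * p * M)\<^sup>2 * (a - M * p)\<^sup>2"
proof -
  have M: "0 < real M" using M_pos by simp
  have "\<epsilon> * p < \<bar>a / M - p\<bar>" using assms(2) by (auto simp: algebra_simps abs_if)
  then have "\<epsilon> * p * M \<le> \<bar>a / M - p\<bar> * M" using M by simp
  also have "\<dots> = \<bar>(a / M - p) * M\<bar>" using M by (simp add: abs_mult)
  also have "(a / M - p) * M = a - M * p" using M by (simp add: field_simps)
  finally have "(\<epsilon> * p * M)\<^sup>2 \<le> \<bar>a - M * p\<bar>\<^sup>2" using \<epsilon> assms(1) by (intro power_mono) auto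
  moreover have "0 < (\<epsilon> * p * M)\<^sup>2" using \<epsilon> assms(1) M by simp
  ultimately show ?thesis by (simp add: le_divide_eq)
qed

text \<open>This fixes the 5 in \<open>M\<close>: by \<open>P_unblocked\<close>,
  \<open>(2 / q)\<^sup>2\<close> is at most 5 times the squared marginal, as 4 \<le> 5 *
  \<open>(63 / 65)\<^sup>2\<close>.\<close>

lemma variance_bound:
  assumes "c \<in> {1..q}" "\<not> blocked c"
  shows "1 / (\<epsilon> * P (k\<^sub>0(v := c)) * M)\<^sup>2 * (M * (2 / q)\<^sup>2) \<le> \<delta> / q"
proof -
  let ?p = "P (k\<^sub>0(v := c))"
  have q: "0 < real q" using q_pos by simp
  have M: "0 < real M" using M_pos by simp
  have p: "63 / 65 / q \<le> ?p" by (rule P_unblocked[OF assms])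
  then have p0: "0 < ?p" using q by (auto intro: less_le_trans[rotated])
  have "(63 / 65 / q)\<^sup>2 \<le> ?p\<^sup>2" using p by (intro power_mono) auto
  then have "(2 / q)\<^sup>2 \<le> 5 * ?p\<^sup>2" using q by (simp add: power_divide field_simps)
  then have "M * (2 / q)\<^sup>2 * q \<le> M * (5 * ?p\<^sup>2) * q" using M q by simp
  also have "\<dots> = M * ?p\<^sup>2 * (5 * q)" by simp
  also have "\<dots> \<le> M * ?p\<^sup>2 * (M * (\<epsilon>\<^sup>2 * \<delta>))" using M M_ge by (intro mult_left_mono) auto
  also have "\<dots> = \<delta> * (\<epsilon> * ?p * M)\<^sup>2" by (simp add: power2_eq_square)
  finally have "M * (2 / q)\<^sup>2 * q \<le> \<delta> * (\<epsilon> * ?p * M)\<^sup>2" .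
  moreover have "0 < (\<epsilon> * ?p * M)\<^sup>2" using \<epsilon> p0 M by simp
  moreover have "1 / A * B \<le> \<delta> / q" if "B * q \<le> \<delta> * A" "0 < A" for A B :: real
    using that q by (simp add: field_simps)
  ultimately show ?thesis by blast
qed

lemma ert_color_body:
  assumes inv: "color_inv s" and guard: "bval color_guard s"
  shows "\<kappa> + ert adj \<kappa> color_body color_pot s \<le> ennreal (color_val s)"
proof -
  define c where "c = nats s 12 0"
  define B where "B = (of_bool (\<exists>c'\<in>{1..<c}. bad s c') :: real)"
  define R where "R = (real q - c) * (\<delta> / q) + \<kappa> * (color_cost * (real q - c) + 1)"
  have c: "c \<in> {1..q}"
    using inv guard by (simp add: color_inv_def color_guard_def c_def load_def)
  have R: "0 \<le> R" unfolding R_def using c \<delta> \<kappa> color_cost_nonneg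
    by (intro add_nonneg_nonneg mult_nonneg_nonneg) auto
  have B: "0 \<le> B" by (simp add: B_def)
  have q: "0 < real q" using q_pos by simp
  have val: "color_val s = B + \<delta> / q + \<kappa> * color_cost + R"
    using q by (simp add: color_val_def B_def R_def c_def algebra_simps add_divide_distrib)
  have bad_less: "bad s' c' \<longleftrightarrow> bad s c'" if "reals s' 1 c' = reals s 1 c'" for s' c'
    using that by (simp add: bad_def estimate_def)
  have cc: "8 \<le> color_cost" using color_cost_ge by (smt (verit) mult_nonneg_nonneg of_nat_0_le_iff)
  show ?thesis
  proof (cases "blocked c")
    case True
    let ?s = "nset 12 0 (Suc c) s"
    have "\<not> bad s c"
      using inv True c by (simp add: bad_def estimate_def color_inv_def marginal_eq P_blocked c_def)
    moreover have "bad ?s c' \<longleftrightarrow> bad s c'" for c' by (rule bad_less) simp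
    ultimately have "(\<exists>c'\<in>{1..<Suc c}. bad ?s c') \<longleftrightarrow> (\<exists>c'\<in>{1..<c}. bad s c')"
      by (auto simp: less_Suc_eq)
    then have v': "color_val ?s = B + R"
      by (simp add: color_val_def B_def R_def)
    have inv': "color_inv ?s" using inv c by (auto simp: color_inv_def c_def)
    have "\<kappa> + ert adj \<kappa> color_body color_pot s = ((+) (ennreal \<kappa>) ^^ 4) (ennreal (B + R))"
      using True inv c inv' v' by (simp add: color_body_def funpow_numerals color_pot_def c_def color_inv_def)
    also have "\<dots> \<le> ennreal (color_val s)"
    proof (rule add_costs_le[OF order_refl])
      have "4 * \<kappa> \<le> color_cost * \<kappa>" using cc \<kappa> by (intro mult_right_mono) auto
      then show "B + R + real 4 * \<kappa> \<le> color_val s" using \<delta> q by (simp add: val mult.commute add_increasing)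
    qed (use B R \<kappa> in auto)
    finally show ?thesis .
  next
    case False
    define p where "p = P (k\<^sub>0(v := c))"
    have p: "0 < p" using P_unblocked[OF c False] q by (auto simp: p_def intro: less_le_trans[rotated])
    define \<gamma> where "\<gamma> = 1 / (\<epsilon> * p * M)\<^sup>2"
    have \<gamma>: "0 \<le> \<gamma>" by (simp add: \<gamma>_def)
    \<comment> \<open>The 3 units are the failing guard of the sampling loop, storing the mean, and
      advancing the color.\<close>
    define C where "C = B + R + 3 * \<kappa>"
    have C: "0 \<le> C" using B R \<kappa> by (simp add: C_def)
    let ?f = "ert adj \<kappa> (RSet 1 (var 12) (RDivide (rvar 3) (OfNat (var 13))))
       (ert adj \<kappa> (NSet 12 (Const 0) (NPlus (var 12) (Const 1))) color_pot)"
    have f: "\<kappa> + ?f s' \<le> ennreal (\<gamma> * (reals s' 3 0 - M * P (k\<^sub>0(v := c)))\<^sup>2 + C)"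
      if s': "sample_inv c (nats s 14) (reals s 1) s'" and m: "nats s' 13 0 = M" for s'
    proof -
      define a where "a = reals s' 3 0"
      let ?s = "nset 12 0 (Suc c) (rset 1 c (a / M) s')"
      have inv': "color_inv ?s"
        using inv s' c by (auto simp: color_inv_def sample_inv_def c_def)
      have "bad ?s c' \<longleftrightarrow> bad s c'" if "c' < c" for c'
        using s' that by (intro bad_less) (simp add: sample_inv_def)
      then have "(\<exists>c'\<in>{1..<c}. bad ?s c') \<longleftrightarrow> (\<exists>c'\<in>{1..<c}. bad s c')"
        by (intro bex_cong) simp_all
      moreover have "{1..<Suc c} = insert c {1..<c}" using c by auto
      ultimately have ex: "(\<exists>c'\<in>{1..<Suc c}. bad ?s c') \<longleftrightarrow> (\<exists>c'\<in>{1..<c}. bad s c') \<or> bad ?s c"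
        by (simp only: bex_simps) blast
      have cheb: "of_bool (bad ?s c) \<le> \<gamma> * (a - M * p)\<^sup>2"
        using bad_chebyshev[OF p, of a] \<gamma> c
        by (cases "bad ?s c") (auto simp: bad_def estimate_def marginal_eq p_def \<gamma>_def)
      have v': "color_val ?s = of_bool ((\<exists>c'\<in>{1..<c}. bad s c') \<or> bad ?s c) + R"
        unfolding color_val_def R_def using ex by simp
      also have "\<dots> \<le> B + \<gamma> * (a - M * p)\<^sup>2 + R"
        using cheb \<gamma> unfolding B_def by (auto simp: of_bool_def split: if_splits)
      finally have v'': "color_val ?s \<le> B + \<gamma> * (a - M * p)\<^sup>2 + R" .
      have "\<kappa> + ?f s' = ((+) (ennreal \<kappa>) ^^ 3) (ennreal (color_val ?s))"
        using s' m inv' by (simp add: funpow_numerals color_pot_def sample_inv_def a_def)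
      also have "\<dots> \<le> ennreal (\<gamma> * (a - M * p)\<^sup>2 + C)"
        using v'' \<kappa> color_val_nonneg[OF inv'] by (intro add_costs_le[OF order_refl]) (auto simp: C_def)
      finally show ?thesis by (simp add: a_def p_def)
    qed
    let ?s = "nset 13 0 0 (rset 3 0 0 s)"
    let ?W = "While sample_guard sample"
    have inv1: "sample_inv c (nats s 14) (reals s 1) ?s"
      using inv by (simp add: sample_inv_def color_inv_def c_def)
    have "ert adj \<kappa> ?W ?f ?s \<le> sample_pot \<gamma> c (nats s 14) (reals s 1) C ?s"
      by (rule ert_sample_loop[OF \<gamma> C c f])
    also have "\<dots> = ennreal (\<gamma> * (M * (2 / q)\<^sup>2) + \<kappa> * ((100 * real \<Delta> + 8) * M) + C)"
      using inv1 by (simp add: sample_pot_def sample_val_def)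
    finally have W: "ert adj \<kappa> ?W ?f ?s \<le> ennreal (\<gamma> * (M * (2 / q)\<^sup>2) + \<kappa> * ((100 * real \<Delta> + 8) * M) + C)" .
    have "\<kappa> + ert adj \<kappa> color_body color_pot s = ((+) (ennreal \<kappa>) ^^ 4) (ert adj \<kappa> ?W ?f ?s)"
      using False inv c by (simp add: color_body_def color_mean_def funpow_numerals c_def color_inv_def ert_Seq
          del: ert.simps(2,3,8)) (simp del: ert.simps(2,3,8) add: ert.simps(2,3))
    also have "\<dots> \<le> ennreal (color_val s)"
    proof (rule add_costs_le[OF W])
      have "\<gamma> * (M * (2 / q)\<^sup>2) \<le> \<delta> / q" unfolding \<gamma>_def p_def by (rule variance_bound[OF c False])
      moreover have "\<kappa> * ((100 * real \<Delta> + 8) * M + 8) \<le> \<kappa> * color_cost"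
        using color_cost_ge \<kappa> by (intro mult_left_mono) auto
      ultimately show "\<gamma> * (M * (2 / q)\<^sup>2) + \<kappa> * ((100 * real \<Delta> + 8) * M) + C + real 4 * \<kappa> \<le> color_val s"
        using \<kappa> unfolding val C_def by (simp add: distrib_left)
    qed (use \<gamma> \<kappa> C in auto)
    finally show ?thesis .
  qed
qed

lemma ert_color_loop: "ert adj \<kappa> (While color_guard color_body) failed s \<le> color_pot s"
proof (rule ert_While_le)
  fix s :: state
  have "\<kappa> + failed s \<le> ennreal (color_val s)" if "color_inv s" "\<not> bval color_guard s"
  proof -
    have "nats s 12 0 = q + 1"
      using that by (simp add: color_inv_def color_guard_def load_def)
    then have "color_val s = of_bool (\<exists>c\<in>{1..q}. bad s c) + \<kappa>"
      by (simp add: color_val_def atLeastLessThanSuc_atLeastAtMost)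
    then show ?thesis using \<kappa> by (simp add: failed_def add.commute flip: ennreal_plus)
  qed
  then show "\<kappa> + (if bval color_guard s then ert adj \<kappa> color_body color_pot s else failed s) \<le> color_pot s"
    using ert_color_body by (auto simp: color_pot_def)
qed

section \<open>Loading the partial coloring and marking blocked colors\<close>

definition total :: real where "total = \<delta> + \<kappa> * (color_cost * q + 1)"

lemma total_nonneg: "0 \<le> total"
  using \<delta> \<kappa> color_cost_nonneg by (simp add: total_def)

text \<open>Uncolored neighbors mark index 0, which is no color; hence the range from 1 to
  \<open>q\<close> in the clause on array 14.\<close>

definition mark_inv :: "state \<Rightarrow> bool" where
  "mark_inv s \<longleftrightarrow> nats s 0 = load [q, v, length vs] \<and> nats s 3 = k\<^sub>0 \<and> nats s 9 0 \<le> length (adj v) \<and>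
     nats s 10 0 = probe adj v (nats s 9 0) \<and>
     (\<forall>c\<in>{1..q}. 0 < nats s 14 c \<longleftrightarrow> (\<exists>y\<in>set (take (nats s 9 0) (adj v)). k\<^sub>0 y = c)) \<and>
     reals s 0 = load [\<epsilon>, \<delta>] \<and> reals s 1 = (\<lambda>_. 0)"

definition mark_pot where
  "mark_pot s = (if mark_inv s
     then ennreal (total + \<kappa> * (4 * (real (length (adj v)) - nats s 9 0) + 2)) else \<top>)"

lemma ert_mark_loop:
  "ert adj \<kappa> (While mark_guard mark_body)
     (ert adj \<kappa> (NSet 12 (Const 0) (Const 1) ;; While color_guard color_body) failed) s \<le> mark_pot s"
proof (rule ert_While_le)
  fix s :: state
  let ?f = "ert adj \<kappa> (NSet 12 (Const 0) (Const 1) ;; While color_guard color_body) failed"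
  define j where "j = nats s 9 0"
  define t where "t = total + \<kappa> * (4 * (real (length (adj v)) - j) + 2)"
  have step: "\<kappa> + ert adj \<kappa> mark_body mark_pot s \<le> ennreal t" if inv: "mark_inv s" and guard: "bval mark_guard s"
  proof -
    have j: "j < length (adj v)"
      using that by (auto simp: mark_inv_def mark_guard_def probe_def j_def split: if_splits)
    let ?s = "nset 10 0 (probe adj v (Suc j)) (nset 9 0 (Suc j) (nset 14 (k\<^sub>0 (adj v ! j)) (Suc 0) s))"
    have "mark_inv ?s"
      using inv j by (auto simp: mark_inv_def take_Suc_conv_app_nth j_def)
    then have "\<kappa> + ert adj \<kappa> mark_body mark_pot s =
        ((+) (ennreal \<kappa>) ^^ 4) (ennreal (total + \<kappa> * (4 * (real (length (adj v)) - real (Suc j)) + 2)))"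
      using inv j by (simp add: mark_body_def funpow_numerals mark_pot_def mark_inv_def probe_def load_def j_def)
    also have "\<dots> \<le> ennreal t"
      using \<kappa> j total_nonneg
      by (intro add_costs_le[OF order_refl] add_nonneg_nonneg mult_nonneg_nonneg) (auto simp: t_def algebra_simps)
    finally show ?thesis .
  qed
  have exit: "\<kappa> + ?f s \<le> ennreal t" if inv: "mark_inv s" and guard: "\<not> bval mark_guard s"
  proof -
    have j: "j = length (adj v)"
      using that by (auto simp: mark_inv_def mark_guard_def probe_def j_def split: if_splits)
    let ?s = "nset 12 0 (Suc 0) s"
    have "color_inv ?s"
      using inv j by (auto simp: mark_inv_def color_inv_def j_def blocked_def)
    then have "color_pot ?s = ennreal total"
      using q_pos by (simp add: color_pot_def color_val_def total_def)
    then have "\<kappa> + ?f s \<le> ((+) (ennreal \<kappa>) ^^ 2) (ennreal total)"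
      using ert_color_loop[of ?s] by (simp add: funpow_numerals add_left_mono del: ert.simps(8))
    also have "\<dots> \<le> ennreal t"
      using \<kappa> total_nonneg j by (intro add_costs_le[OF order_refl]) (auto simp: t_def)
    finally show ?thesis .
  qed
  show "\<kappa> + (if bval mark_guard s then ert adj \<kappa> mark_body mark_pot s else ?f s) \<le> mark_pot s"
    using step exit by (auto simp: mark_pot_def t_def j_def simp del: ert.simps)
qed

definition load_inv :: "state \<Rightarrow> bool" where
  "load_inv s \<longleftrightarrow> nats s 0 = load [q, v, length vs] \<and> nats s 1 = load vs \<and> nats s 2 = load (map \<sigma> vs) \<and>
     nats s 15 0 \<le> length vs \<and> nats s 3 = (\<lambda>x. if x \<in> set (take (nats s 15 0) vs) then \<sigma> x else 0) \<and>
     nats s 9 0 = 0 \<and> nats s 14 = (\<lambda>_. 0) \<and> reals s 0 = load [\<epsilon>, \<delta>] \<and> reals s 1 = (\<lambda>_. 0)"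

definition load_pot where
  "load_pot s = (if load_inv s
     then ennreal (total + \<kappa> * (3 * (real (length vs) - nats s 15 0) + 4 * real \<Delta> + 4)) else \<top>)"

lemma ert_estimator: "load_inv s \<Longrightarrow> ert adj \<kappa> estimator failed s \<le> load_pot s"
proof -
  let ?f = "ert adj \<kappa> (Probe 10 (Const 0) the_vertex (Const 0) ;; While mark_guard mark_body ;;
     NSet 12 (Const 0) (Const 1) ;; While color_guard color_body) failed"
  have "ert adj \<kappa> (While load_guard load_body) ?f s \<le> load_pot s"
  proof (rule ert_While_le)
    fix s :: state
    define i where "i = nats s 15 0"
    define t where "t = total + \<kappa> * (3 * (real (length vs) - i) + 4 * real \<Delta> + 4)"
    have step: "\<kappa> + ert adj \<kappa> load_body load_pot s \<le> ennreal t" if inv: "load_inv s" and guard: "bval load_guard s"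
    proof -
      have i: "i < length vs"
        using that by (simp add: load_inv_def load_guard_def load_def i_def)
      let ?s = "nset 15 0 (Suc i) (nset 3 (vs ! i) (\<sigma> (vs ! i)) s)"
      have "load_inv ?s"
        using inv i by (auto simp: load_inv_def take_Suc_conv_app_nth i_def)
      then have "\<kappa> + ert adj \<kappa> load_body load_pot s =
          ((+) (ennreal \<kappa>) ^^ 3) (ennreal (total + \<kappa> * (3 * (real (length vs) - real (Suc i)) + 4 * real \<Delta> + 4)))"
        using inv i by (simp add: load_body_def funpow_numerals load_pot_def load_inv_def load_def i_def)
      also have "\<dots> \<le> ennreal t"
        using \<kappa> i total_nonneg
        by (intro add_costs_le[OF order_refl] add_nonneg_nonneg mult_nonneg_nonneg) (auto simp: t_def algebra_simps)
      finally show ?thesis .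
    qed
    have exit: "\<kappa> + ?f s \<le> ennreal t" if inv: "load_inv s" and guard: "\<not> bval load_guard s"
    proof -
      have i: "i = length vs"
        using that by (simp add: load_inv_def load_guard_def load_def i_def)
      let ?s = "nset 10 0 (probe adj v 0) s"
      have "mark_inv ?s"
        using inv i vs by (auto simp: load_inv_def mark_inv_def i_def k\<^sub>0_def fun_eq_iff)
      then have pot: "mark_pot ?s = ennreal (total + \<kappa> * (4 * real (length (adj v)) + 2))"
        using inv by (simp add: mark_pot_def load_inv_def)
      have v1: "nats s 0 (Suc 0) = v" using inv by (simp add: load_inv_def load_def)
      have "\<kappa> + ?f s \<le> ((+) (ennreal \<kappa>) ^^ 2) (ennreal (total + \<kappa> * (4 * real (length (adj v)) + 2)))"
        unfolding pot[symmetric] using ert_mark_loop[of ?s]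
        by (simp add: funpow_numerals add_left_mono ert_Seq v1 del: ert.simps(2,8))
      also have "\<dots> \<le> ennreal t"
      proof (rule add_costs_le[OF order_refl])
        have "length (adj v) \<le> \<Delta>" using v by (intro length_adj) simp
        then have "\<kappa> * (4 * real (length (adj v)) + 4) \<le> \<kappa> * (4 * real \<Delta> + 4)"
          using \<kappa> by (intro mult_left_mono) auto
        then show "total + \<kappa> * (4 * real (length (adj v)) + 2) + real 2 * \<kappa> \<le> t"
          by (simp add: t_def i algebra_simps)
      qed (use \<kappa> total_nonneg in auto)
      finally show ?thesis .
    qed
    show "\<kappa> + (if bval load_guard s then ert adj \<kappa> load_body load_pot s else ?f s) \<le> load_pot s"
      using step exit by (auto simp: load_pot_def t_def i_def simp del: ert.simps)
  qed
  then show ?thesis by (simp only: estimator_def ert_Seq)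
qed

lemma ert_estimator_input:
  "ert adj \<kappa> estimator failed (input q vs \<sigma> v \<epsilon> \<delta>) \<le>
     ennreal (\<delta> + \<kappa> * (color_cost * q + 3 * real (length vs) + 4 * real \<Delta> + 5))"
proof -
  let ?s = "input q vs \<sigma> v \<epsilon> \<delta>"
  have "load_inv ?s" by (simp add: load_inv_def input_def)
  moreover have "load_pot ?s = ennreal (\<delta> + \<kappa> * (color_cost * q + 3 * real (length vs) + 4 * real \<Delta> + 5))"
    using \<open>load_inv ?s\<close> by (simp add: load_pot_def input_def total_def algebra_simps)
  ultimately show ?thesis using ert_estimator[of ?s] by simp
qed

end

theorem theorem1p7:
  shows "\<exists>(alg :: com) (C :: real). C > 0 \<and>
    (\<forall>(G :: nat pair_pre_digraph) (adj :: nat \<Rightarrow> nat list) (q :: nat) (\<Lambda> :: nat set) (vs :: nat list)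
       (\<sigma> :: nat \<Rightarrow> nat) (v :: nat) (\<epsilon> :: real) (\<delta> :: real).
       pair_graph G \<longrightarrow> adjacency_lists G adj \<longrightarrow>
       max_degree G \<ge> 1 \<longrightarrow> q \<ge> 65 * max_degree G \<longrightarrow>
       \<Lambda> \<subseteq> pverts G \<longrightarrow> partial_proper_coloring G q \<Lambda> \<sigma> \<longrightarrow> distinct vs \<longrightarrow> set vs = \<Lambda> \<longrightarrow>
       v \<in> pverts G - \<Lambda> \<longrightarrow> 0 < \<epsilon> \<longrightarrow> \<epsilon> < 1 \<longrightarrow> 0 < \<delta> \<longrightarrow> \<delta> < 1 \<longrightarrow>
       (let R = exec adj alg (input q vs \<sigma> v \<epsilon> \<delta>) in
          measure (measure_spmf R) {(t, s). \<forall>c \<in> {1..q}.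
              (1 - \<epsilon>) * marginal G q \<Lambda> \<sigma> v c \<le> estimate s c \<and>
              estimate s c \<le> (1 + \<epsilon>) * marginal G q \<Lambda> \<sigma> v c} \<ge> 1 - \<delta> \<and>
          expected_time R \<le>
            ennreal (C * (1 / \<epsilon> ^ 2) * (1 / \<delta>) * real (max_degree G) ^ 2 * real q ^ 3 *
              real (max 1 (card \<Lambda>)))))"
proof (intro exI[of _ estimator] exI[of _ "1000 :: real"] conjI allI impI)
  fix G :: "nat pair_pre_digraph" and adj q \<Lambda> vs \<sigma> v and \<epsilon> \<delta> :: real
  assume A: "pair_graph G" "adjacency_lists G adj" "1 \<le> max_degree G" "65 * max_degree G \<le> q"
    "\<Lambda> \<subseteq> pverts G" "partial_proper_coloring G q \<Lambda> \<sigma>" "distinct vs" "set vs = \<Lambda>"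
    "v \<in> pverts G - \<Lambda>" "0 < \<epsilon>" "\<epsilon> < 1" "0 < \<delta>" "\<delta> < 1"
  define \<Delta> where "\<Delta> = max_degree G"
  have inst: "sampling_instance G adj q \<Lambda> \<sigma> v \<Delta> vs \<epsilon> \<delta> \<kappa>" if "0 \<le> \<kappa>" for \<kappa>
    using A that by (simp add: sampling_instance_def coloring_instance_def sampling_instance_axioms_def \<Delta>_def)
  interpret I: sampling_instance G adj q \<Lambda> \<sigma> v \<Delta> vs \<epsilon> \<delta> 1 by (rule inst) simp
  define R where "R = exec adj estimator (input q vs \<sigma> v \<epsilon> \<delta>)"
  define T where "T = I.color_cost * q + 3 * real (length vs) + 4 * real \<Delta> + 5"
  have T: "0 \<le> T" using I.color_cost_nonneg by (simp add: T_def)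
  have ert: "ert adj \<kappa> estimator I.failed (input q vs \<sigma> v \<epsilon> \<delta>) \<le> ennreal (\<delta> + \<kappa> * T)" if "0 \<le> \<kappa>" for \<kappa>
    unfolding T_def by (rule sampling_instance.ert_estimator_input[OF inst[OF that]])
  have cost: "cost \<kappa> I.failed R \<le> ennreal (\<delta> + \<kappa> * T)" if "0 \<le> \<kappa>" for \<kappa>
    unfolding R_def by (rule order_trans[OF cost_exec_le_ert ert[OF that]])
  have lossless: "lossless_spmf R"
    unfolding R_def using ert[of 1]
    by (intro lossless_exec[of 1 adj estimator I.failed]) (auto intro: le_less_trans)
  let ?good = "{(t, s). \<forall>c \<in> {1..q}. (1 - \<epsilon>) * marginal G q \<Lambda> \<sigma> v c \<le> estimate s c \<and>
      estimate s c \<le> (1 + \<epsilon>) * marginal G q \<Lambda> \<sigma> v c}"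
  have "measure (measure_spmf R) (- ?good) \<le> \<delta> + e" if "0 < e" for e
  proof -
    \<comment> \<open>With this rate the running time adds at most \<open>e\<close> to the bound on
      the failure probability.\<close>
    define \<kappa> where "\<kappa> = e / (T + 1)"
    have \<kappa>: "0 \<le> \<kappa>" "\<kappa> * T \<le> e" using that T by (simp_all add: \<kappa>_def field_simps)
    have "emeasure (measure_spmf R) (- ?good) = (\<integral>\<^sup>+ x. indicator (- ?good) x \<partial>measure_spmf R)"
      by simp
    also have "\<dots> \<le> cost \<kappa> I.failed R"
      unfolding cost_def
      by (intro nn_integral_mono) (auto simp: I.failed_def I.bad_def indicator_def)
    also have "\<dots> \<le> ennreal (\<delta> + \<kappa> * T)" by (rule cost[OF \<kappa>(1)])
    also have "\<dots> \<le> ennreal (\<delta> + e)" using \<kappa> by (intro ennreal_leI) simp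
    finally show ?thesis
      using A that unfolding measure_spmf.emeasure_eq_measure by (subst (asm) ennreal_le_iff) auto
  qed
  then have "measure (measure_spmf R) (- ?good) \<le> \<delta>" by (rule field_le_epsilon)
  moreover have "measure (measure_spmf R) (- ?good) = 1 - measure (measure_spmf R) ?good"
    using lossless measure_spmf.finite_measure_compl[of ?good R]
    by (simp add: Compl_eq_Diff_UNIV lossless_spmf_def space_measure_spmf)
  ultimately have prob: "1 - \<delta> \<le> measure (measure_spmf R) ?good" by simp
  have "expected_time R \<le> cost 1 I.failed R"
    unfolding expected_time_def cost_def using lossless by (auto intro!: nn_integral_mono)
  also have "\<dots> \<le> ennreal (\<delta> + T)" using cost[of 1] by simp
  also have "\<dots> \<le> ennreal (1000 * (1 / \<epsilon> ^ 2) * (1 / \<delta>) * real (max_degree G) ^ 2 * real q ^ 3 *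
              real (max 1 (card \<Lambda>)))"
  proof (rule ennreal_leI)
    define z where "z = 1 / (\<epsilon>\<^sup>2 * \<delta>)"
    define n where "n = real (max 1 (card \<Lambda>))"
    define D where "D = real \<Delta>"
    define Q where "Q = real q"
    have z: "1 \<le> z" using I.\<epsilon>\<delta> by (simp add: z_def)
    have n: "1 \<le> n" "real (length vs) \<le> n" using A distinct_card[of vs] by (auto simp: n_def)
    have D: "1 \<le> D" using A by (simp add: D_def \<Delta>_def)
    have Q: "1 \<le> Q" using I.q_pos by (simp add: Q_def)
    have "1 \<le> D\<^sup>2" "1 \<le> Q ^ 3" using D Q by (auto intro: one_le_power)
    moreover have "D \<le> D\<^sup>2" "Q\<^sup>2 \<le> Q ^ 3"
      using D Q by (auto simp: power2_eq_square power3_eq_cube)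
    ultimately have DQ: "1 \<le> D\<^sup>2" "1 \<le> Q ^ 3" "D \<le> D\<^sup>2" "Q\<^sup>2 \<le> Q ^ 3" .
    have zn: "1 \<le> z * n" using mult_mono[OF z n(1)] z by simp
    \<comment> \<open>In the actual bound the length of the input and \<Delta> are only additive.
      Each summand is below the product because all factors are at least 1, with
      \<open>max 1\<close> for empty \<Lambda>; the coefficients 800, 3, 4 and 6 add up to less than
      1000.\<close>
    have 1: "D * Q\<^sup>2 * (z * 1) \<le> D\<^sup>2 * Q ^ 3 * (z * n)"
      using D Q DQ z n by (intro mult_mono) auto
    have 2: "1 * 1 * (1 * n) \<le> D\<^sup>2 * Q ^ 3 * (z * n)"
      using D Q DQ z n by (intro mult_mono) auto
    have 3: "D * 1 * (1 * 1) \<le> D\<^sup>2 * Q ^ 3 * (z * n)"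
      using D Q DQ z n by (intro mult_mono) auto
    have 4: "1 * 1 * (1 * 1) \<le> D\<^sup>2 * Q ^ 3 * (z * n)"
      using D Q DQ z n by (intro mult_mono) auto
    have "\<delta> + T \<le> 800 * (D * Q\<^sup>2 * z) + 3 * n + 4 * D + 6"
      using n A by (simp add: T_def I.color_cost_def z_def D_def Q_def power2_eq_square)
    also have "\<dots> \<le> 1000 * (D\<^sup>2 * Q ^ 3 * (z * n))" using 1 2 3 4 by simp
    also have "\<dots> = 1000 * (1 / \<epsilon> ^ 2) * (1 / \<delta>) * real (max_degree G) ^ 2 * real q ^ 3 *
              real (max 1 (card \<Lambda>))"
      by (simp add: z_def n_def D_def Q_def \<Delta>_def)
    finally show "\<delta> + T \<le> \<dots>" .
  qed
  finally show "let R = exec adj estimator (input q vs \<sigma> v \<epsilon> \<delta>) in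
      1 - \<delta> \<le> measure (measure_spmf R) ?good \<and>
      expected_time R \<le> ennreal (1000 * (1 / \<epsilon> ^ 2) * (1 / \<delta>) * real (max_degree G) ^ 2 * real q ^ 3 *
              real (max 1 (card \<Lambda>)))"
    using prob by (simp add: R_def Let_def)
qed simp

end
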